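(* Let $\{x_j\}_{j\geq 1}$ be an i.i.d. sequence of $\mathbb{R}\setminus\{0\}$-valued random variables such that \[ \mathbb{E}\left[\log\big(1+|x_1|\big)\right]<\infty\quad\text{and}\quad\mathbb{E}\left[\log\left(1+\frac{1}{|x_1|}\right)\right]<\infty . \] For $j\geq 1$ let \[ Y_j=\begin{bmatrix}1 & x_j\\ \frac{1}{x_j} & 1\end{bmatrix}, \] and for $n\ge 1$ let $S_n=Y_n\cdots Y_2\cdot Y_1$. Let $\|\cdot\|$ be a matrix norm and let $\lambda:=\lim_{n\to\infty}\frac1n\mathbb{E}\big[\log\|S_n\|\big]\in[-\infty,\infty]$ be the Lyapunov exponent. Then almost surely \[ \lambda=\lim_{n\to\infty}\frac{1}{n}\log\left\Vert S_n\right\Vert<\infty, \] and the Lyapunov exponent has the explicit representation \[ \lambda=\mathbb{E}\left[\log\left|1+\frac{x_2}{x_1}\right|\right]. \]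
   Context: The convention $\log 0=-\infty$ is used. The Lyapunov exponent $\lambda$ of an i.i.d. sequence of random matrices with partial products $S_n$ is defined by $\lambda=\lim_{n\to\infty}\frac1n\mathbb{E}[\log\|S_n\|]$; it takes values in $[-\infty,\infty]$ (so the value $-\infty$ is allowed, both for $\lambda$ and for the expectation in the explicit representation), and does not depend on the choice of matrix norm. *)

theory Defs
  imports "HOL-Probability.Probability"
begin

text \<open>Logarithm of a nonnegative real with \<open>log 0 = -\<infinity>\<close>. (In the library, \<open>ln 0 = 0\<close>.)
  It is only applied to values of norms and absolute values.\<close>

definition elog :: "real \<Rightarrow> ereal" where
  "elog t = (if t = 0 then -\<infinity> else ereal (ln t))"

text \<open>Expectation of extended-real-valued functions as the difference of the integrals of the
  positive and negative parts; \<^const>\<open>e2ennreal\<close> maps negative numbers to \<open>0\<close>. Since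
  \<open>\<infinity> - \<infinity> = \<infinity>\<close> in \<^typ>\<open>ereal\<close>, the value of \<open>ext_expectation\<close> is only meaningful together
  with \<open>has_ext_expectation\<close>.\<close>

definition ext_expectation :: "'a measure \<Rightarrow> ('a \<Rightarrow> ereal) \<Rightarrow> ereal" where
  "ext_expectation M f =
     enn2ereal (\<integral>\<^sup>+\<omega>. e2ennreal (f \<omega>) \<partial>M) - enn2ereal (\<integral>\<^sup>+\<omega>. e2ennreal (- f \<omega>) \<partial>M)"

definition has_ext_expectation :: "'a measure \<Rightarrow> ('a \<Rightarrow> ereal) \<Rightarrow> bool" where
  "has_ext_expectation M f \<longleftrightarrow>
     f \<in> borel_measurable M \<and>
     ((\<integral>\<^sup>+\<omega>. e2ennreal (f \<omega>) \<partial>M) < \<infinity> \<or> (\<integral>\<^sup>+\<omega>. e2ennreal (- f \<omega>) \<partial>M) < \<infinity>)"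

text \<open>A norm on the vector space of square matrices. Submultiplicativity is not demanded, so
  submultiplicative norms are a special case.\<close>

definition matrix_norm :: "(real^'n^'n \<Rightarrow> real) \<Rightarrow> bool" where
  "matrix_norm N \<longleftrightarrow>
     (\<forall>A. 0 \<le> N A) \<and>
     (\<forall>A. N A = 0 \<longleftrightarrow> A = 0) \<and>
     (\<forall>c A. N (c *\<^sub>R A) = \<bar>c\<bar> * N A) \<and>
     (\<forall>A B. N (A + B) \<le> N A + N B)"

text \<open>The product \<open>Z n ** \<dots> ** Z 2 ** Z 1\<close>; the value \<open>Z 0\<close> is not used.\<close>

primrec partial_product :: "(nat \<Rightarrow> 'a \<Rightarrow> real^'n^'n) \<Rightarrow> nat \<Rightarrow> 'a \<Rightarrow> real^'n^'n" where
  "partial_product Z 0 \<omega> = mat 1"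
| "partial_product Z (Suc n) \<omega> = Z (Suc n) \<omega> ** partial_product Z n \<omega>"

definition mean_log_growth ::
  "'a measure \<Rightarrow> (real^'n^'n \<Rightarrow> real) \<Rightarrow> (nat \<Rightarrow> 'a \<Rightarrow> real^'n^'n) \<Rightarrow> nat \<Rightarrow> ereal" where
  "mean_log_growth M N Z n =
     ereal (1 / real n) * ext_expectation M (\<lambda>\<omega>. elog (N (partial_product Z n \<omega>)))"

definition lyapunov_exponent ::
  "'a measure \<Rightarrow> (real^'n^'n \<Rightarrow> real) \<Rightarrow> (nat \<Rightarrow> 'a \<Rightarrow> real^'n^'n) \<Rightarrow> ereal" where
  "lyapunov_exponent M N Z = lim (mean_log_growth M N Z)"

definition Y_mat :: "real \<Rightarrow> real^2^2" where
  "Y_mat t = vector [vector [1, t], vector [1 / t, 1]]"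

end

(* Each Y_j is the rank-one matrix (1, 1/x_j)^T (1, x_j), so S_n telescopes to the product over
   j < n of 1 + x_(j+1)/x_j times (1, 1/x_n)^T (1, x_1). The norm of the last matrix is bounded below
   by a positive constant and above by a constant times (1 + |x_1|) (1 + 1/|x_n|), so its logarithm
   is o(n) almost surely and bounded in mean. The rest is a strong law of large numbers for the
   stationary sequence log |1 + x_(j+1)/x_j|, deduced from a maximal inequality and Kolmogorov's
   zero-one law; if the mean is -oo, it is applied to truncations from below. *)
theory Submission
  imports Defs
begin

text \<open>Neighbouring ratios share a variable, so their logarithms are dependent and the strong
  law for i.i.d. summands does not apply to them. The law proved here is for a function of the whole
  shifted sequence \<open>\<lambda>i. X (j + i)\<close>: every tail of an i.i.d. sequence has the
  law of the sequence itself, and shift-invariant events have probability 0 or 1. This is all the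
  ergodicity that enters. The two moment conditions act through 1 + |b|/|a| <= (1 + |b|)(1 + 1/|a|):
  they make the positive part of log |1 + x_2/x_1| integrable and control the boundary matrix. Only
  the negative part can have infinite mean, so the case distinction is made there. If it is finite,
  almost surely no ratio vanishes and \<open>elog\<close> becomes the real logarithm. If it is
  infinite, ratios may vanish with positive probability, but the limit -\<infinity> follows from
  upper bounds alone, and these stay true when a factor is 0.\<close>

subsection \<open>A strong law of large numbers for shifts of i.i.d. sequences\<close>

text \<open>\<open>partial_max f n w\<close> is the maximum over \<open>k \<le> n\<close> of the partial sums
  \<open>\<Sum>j<k. f (\<lambda>i. w (j + i))\<close>; the recursion peels off the first summand.\<close>

primrec partial_max :: "((nat \<Rightarrow> 'b) \<Rightarrow> real) \<Rightarrow> nat \<Rightarrow> (nat \<Rightarrow> 'b) \<Rightarrow> real" where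
  "partial_max f 0 w = 0"
| "partial_max f (Suc n) w = max 0 (f w + partial_max f n (\<lambda>i. w (Suc i)))"

lemma partial_max_nonneg: "0 \<le> partial_max f n w"
  by (cases n) auto

lemma partial_max_Suc_ge: "partial_max f n w \<le> partial_max f (Suc n) w"
proof (induction n arbitrary: w)
  case (Suc n)
  show ?case
    using Suc[of "\<lambda>i. w (Suc i)"] by (auto simp: max_def)
qed simp

lemma partial_max_mono: "m \<le> n \<Longrightarrow> partial_max f m w \<le> partial_max f n w"
  by (rule lift_Suc_mono_le[of "\<lambda>n. partial_max f n w"]) (rule partial_max_Suc_ge)

text \<open>With monotonicity in \<open>n\<close>, this makes unbounded sums force
  \<open>partial_max f n w\<close> to infinity, which is how unboundedness enters the maximal
  inequality.\<close>

lemma sum_le_partial_max: "(\<Sum>j<n. f (\<lambda>i. w (j + i))) \<le> partial_max f n w"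
proof (induction n arbitrary: w)
  case (Suc n)
  have "(\<Sum>j<Suc n. f (\<lambda>i. w (j + i))) = f w + (\<Sum>j<n. f (\<lambda>i. w (Suc (j + i))))"
    by (subst sum.lessThan_Suc_shift) simp
  also have "\<dots> \<le> f w + partial_max f n (\<lambda>i. w (Suc i))"
    using Suc[of "\<lambda>i. w (Suc i)"] by simp
  finally show ?case
    by (simp del: sum.lessThan_Suc)
qed simp

lemma measurable_shift:
  "(\<lambda>w i. w (m + i)) \<in> measurable (PiM UNIV (\<lambda>_. D)) (PiM UNIV (\<lambda>_. D))"
  by (rule measurable_PiM_single') (auto simp: space_PiM)

lemma measurable_partial_max:
  assumes f: "f \<in> borel_measurable (PiM UNIV (\<lambda>_. D))"
  shows "partial_max f n \<in> borel_measurable (PiM UNIV (\<lambda>_. D))"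
proof (induction n)
  case (Suc n)
  have "(\<lambda>w. partial_max f n (\<lambda>i. w (Suc i))) \<in> borel_measurable (PiM UNIV (\<lambda>_. D))"
    using measurable_compose[OF measurable_shift[of 1] Suc] by simp
  with f show ?case
    by simp
qed simp

lemma (in prob_space) indep_vars_reindex:
  assumes indep: "indep_vars M' X (f ` I)" and inj: "inj_on f I"
  shows "indep_vars (\<lambda>i. M' (f i)) (\<lambda>i. X (f i)) I"
  unfolding indep_vars_def2
proof
  show "\<forall>i\<in>I. random_variable (M' (f i)) (X (f i))"
    using indep by (auto simp: indep_vars_def)
  show "indep_sets (\<lambda>i. {X (f i) -` A \<inter> space M | A. A \<in> sets (M' (f i))}) I"
    unfolding indep_sets_def
  proof (intro conjI ballI allI impI)
    fix i assume "i \<in> I"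
    then show "{X (f i) -` A \<inter> space M | A. A \<in> sets (M' (f i))} \<subseteq> events"
      using indep by (auto simp: indep_vars_def)
  next
    fix J A
    assume J: "J \<subseteq> I" "J \<noteq> {}" "finite J"
      and A: "A \<in> Pi J (\<lambda>i. {X (f i) -` A \<inter> space M | A. A \<in> sets (M' (f i))})"
    let ?g = "the_inv_into I f"
    have g: "?g (f i) = i" if "i \<in> J" for i
      using the_inv_into_f_f[OF inj] that J by auto
    have "prob (\<Inter>j\<in>f ` J. A (?g j)) = (\<Prod>j\<in>f ` J. prob (A (?g j)))"
    proof (rule indep_setsD)
      show "indep_sets (\<lambda>i. {X i -` A \<inter> space M | A. A \<in> sets (M' i)}) (f ` I)"
        using indep by (simp add: indep_vars_def2)
      show "\<forall>j\<in>f ` J. A (?g j) \<in> {X j -` A \<inter> space M | A. A \<in> sets (M' j)}"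
        using A by (auto simp: g dest: Pi_mem)
    qed (use J in auto)
    then show "prob (\<Inter>j\<in>J. A j) = (\<Prod>j\<in>J. prob (A j))"
      by (simp add: prod.reindex[OF inj_on_subset[OF inj J(1)]] g)
  qed
qed

section \<open>Stationarity and zero-one law of an i.i.d. sequence\<close>

locale iid_sequence = prob_space M for M :: "'a measure" +
  fixes D :: "'b measure" and X :: "nat \<Rightarrow> 'a \<Rightarrow> 'b"
  assumes indep: "indep_vars (\<lambda>_. D) X UNIV"
    and ident: "\<And>i. distr M D (X i) = distr M D (X 0)"
begin

lemma measurable_X [measurable]: "X i \<in> measurable M D"
  using indep by (auto simp: indep_vars_def)

lemma measurable_tail: "(\<lambda>\<omega> i. X (m + i) \<omega>) \<in> measurable M (PiM UNIV (\<lambda>_. D))"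
  by (rule measurable_PiM_single') (auto dest: measurable_space[OF measurable_X])

text \<open>Independence makes the joint law of a tail a product measure, and equal marginals make
  this product the same for every \<open>m\<close>. This is the stationarity behind the transfer
  lemmas that follow.\<close>

lemma distr_tail:
  "distr M (PiM UNIV (\<lambda>_. D)) (\<lambda>\<omega> i. X (m + i) \<omega>) = PiM UNIV (\<lambda>_. distr M D (X 0))"
proof -
  have "indep_vars (\<lambda>_. D) (\<lambda>i. X (m + i)) UNIV"
    using indep_vars_reindex[OF indep_vars_subset[OF indep subset_UNIV], where f = "(+) m" and I = UNIV]
    by simp
  then have "distr M (PiM UNIV (\<lambda>_. D)) (\<lambda>\<omega> i. X (m + i) \<omega>)
      = PiM UNIV (\<lambda>i. distr M D (X (m + i)))"
    using indep_vars_iff_distr_eq_PiM'[where I = UNIV and M' = "\<lambda>_. D" and X = "\<lambda>i. X (m + i)"]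
    by (simp add: restrict_def)
  also have "\<dots> = PiM UNIV (\<lambda>_. distr M D (X 0))"
    by (intro PiM_cong refl ident)
  finally show ?thesis .
qed

lemma distr_tail_eq:
  "distr M (PiM UNIV (\<lambda>_. D)) (\<lambda>\<omega> i. X (m + i) \<omega>)
    = distr M (PiM UNIV (\<lambda>_. D)) (\<lambda>\<omega> i. X i \<omega>)"
  using distr_tail[of m] distr_tail[of 0] by simp

lemma integrable_tail:
  fixes f :: "(nat \<Rightarrow> 'b) \<Rightarrow> real"
  assumes f: "f \<in> borel_measurable (PiM UNIV (\<lambda>_. D))"
  shows "integrable M (\<lambda>\<omega>. f (\<lambda>i. X (m + i) \<omega>)) \<longleftrightarrow> integrable M (\<lambda>\<omega>. f (\<lambda>i. X i \<omega>))"
  using integrable_distr_eq[OF measurable_tail[of m] f]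
    integrable_distr_eq[OF measurable_tail[of 0] f] distr_tail_eq[of m]
  by simp

lemma integral_tail:
  fixes f :: "(nat \<Rightarrow> 'b) \<Rightarrow> real"
  assumes f: "f \<in> borel_measurable (PiM UNIV (\<lambda>_. D))"
  shows "expectation (\<lambda>\<omega>. f (\<lambda>i. X (m + i) \<omega>)) = expectation (\<lambda>\<omega>. f (\<lambda>i. X i \<omega>))"
  using integral_distr[OF measurable_tail[of m] f]
    integral_distr[OF measurable_tail[of 0] f] distr_tail_eq[of m]
  by simp

lemma nn_integral_tail:
  assumes f: "f \<in> borel_measurable (PiM UNIV (\<lambda>_. D))"
  shows "(\<integral>\<^sup>+\<omega>. f (\<lambda>i. X (m + i) \<omega>) \<partial>M) = (\<integral>\<^sup>+\<omega>. f (\<lambda>i. X i \<omega>) \<partial>M)"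
proof -
  have "(\<integral>\<^sup>+\<omega>. f (\<lambda>i. X (m + i) \<omega>) \<partial>M)
      = integral\<^sup>N (distr M (PiM UNIV (\<lambda>_. D)) (\<lambda>\<omega> i. X (m + i) \<omega>)) f" for m
    using nn_integral_distr[OF measurable_tail[of m], of f] f by simp
  from this[of m] this[of 0] show ?thesis
    by (simp add: distr_tail_eq[of m])
qed

text \<open>Invariance lets the event be written through the coordinates from \<open>n\<close> on,
  for each \<open>n\<close>, so it is a tail event and Kolmogorov's law applies. Invariance is asked
  along sample paths of \<open>X\<close>, not of \<open>E\<close> as a set of sequences.\<close>

lemma zero_one_shift_invariant:
  assumes E: "E \<in> sets (PiM UNIV (\<lambda>_. D))"
    and inv: "\<And>m \<omega>. \<omega> \<in> space M \<Longrightarrow> (\<lambda>i. X (m + i) \<omega>) \<in> E \<longleftrightarrow> (\<lambda>i. X i \<omega>) \<in> E"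
  shows "prob {\<omega> \<in> space M. (\<lambda>i. X i \<omega>) \<in> E} = 0 \<or> prob {\<omega> \<in> space M. (\<lambda>i. X i \<omega>) \<in> E} = 1"
proof (rule kolmogorov_0_1_law)
  let ?A = "\<lambda>i. sigma_sets (space M) {X i -` A \<inter> space M | A. A \<in> sets D}"
  show "sigma_algebra (space M) (?A i)" for i
    by (rule sigma_algebra_sigma_sets) auto
  show "indep_sets ?A UNIV"
    using indep by (simp add: indep_vars_def)
  show "{\<omega> \<in> space M. (\<lambda>i. X i \<omega>) \<in> E} \<in> tail_events ?A"
    unfolding tail_events_def
  proof
    fix n :: nat
    let ?U = "\<Union>(?A ` {n..})"
    have U: "?U \<subseteq> Pow (space M)"
      by (auto dest: sigma_sets_into_sp[rotated])
    have "(\<lambda>\<omega> i. X (n + i) \<omega>) \<in> measurable (sigma (space M) ?U) (PiM UNIV (\<lambda>_. D))"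
    proof (rule measurable_PiM_single')
      fix i
      show "X (n + i) \<in> measurable (sigma (space M) ?U) D"
      proof (rule measurableI)
        fix A assume A: "A \<in> sets D"
        then have "X (n + i) -` A \<inter> space M \<in> ?A (n + i)"
          by auto
        then have "X (n + i) -` A \<inter> space M \<in> ?U"
          by (meson UN_I atLeast_iff le_add1)
        then show "X (n + i) -` A \<inter> space (sigma (space M) ?U) \<in> sets (sigma (space M) ?U)"
          using U by (simp add: space_measure_of_conv sets_measure_of)
      qed (use measurable_space[OF measurable_X] in \<open>simp add: space_measure_of_conv\<close>)
    qed (use measurable_space[OF measurable_X] in \<open>auto simp: space_measure_of_conv\<close>)
    from measurable_sets[OF this E]
    have "{\<omega> \<in> space M. (\<lambda>i. X (n + i) \<omega>) \<in> E} \<in> sigma_sets (space M) ?U"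
      using U by (simp add: space_measure_of_conv sets_measure_of vimage_def Int_def conj_commute)
    also have "{\<omega> \<in> space M. (\<lambda>i. X (n + i) \<omega>) \<in> E} = {\<omega> \<in> space M. (\<lambda>i. X i \<omega>) \<in> E}"
      using inv by auto
    finally show "{\<omega> \<in> space M. (\<lambda>i. X i \<omega>) \<in> E} \<in> sigma_sets (space M) ?U" .
  qed
qed

lemma integrable_partial_max:
  fixes f :: "(nat \<Rightarrow> 'b) \<Rightarrow> real"
  assumes f: "f \<in> borel_measurable (PiM UNIV (\<lambda>_. D))"
    and int: "integrable M (\<lambda>\<omega>. f (\<lambda>i. X i \<omega>))"
  shows "integrable M (\<lambda>\<omega>. partial_max f n (\<lambda>i. X i \<omega>))"
proof (induction n)
  case (Suc n)
  have "integrable M (\<lambda>\<omega>. partial_max f n (\<lambda>i. X (Suc i) \<omega>))"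
    using integrable_tail[OF measurable_partial_max[OF f], of n 1] Suc by simp
  with int show ?case
    by simp
qed simp

text \<open>With \<open>F\<^sub>n\<close> the running maximum and \<open>\<theta>\<close> the shift, \<open>F\<^sub>n\<^sub>+\<^sub>1 - F\<^sub>n \<circ> \<theta> = max (- F\<^sub>n \<circ> \<theta>) f\<close> has
  nonnegative mean because \<open>F\<^sub>n \<circ> \<theta>\<close> and \<open>F\<^sub>n\<close> have the same law. If the sums were almost surely
  unbounded, the right-hand side would converge to \<open>f\<close>, so \<open>f\<close> could not have negative mean. The
  zero-one law turns ``not almost surely unbounded'' into ``almost surely bounded''.\<close>

lemma AE_bdd_above_sums:
  fixes f :: "(nat \<Rightarrow> 'b) \<Rightarrow> real"
  assumes f: "f \<in> borel_measurable (PiM UNIV (\<lambda>_. D))"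
    and int: "integrable M (\<lambda>\<omega>. f (\<lambda>i. X i \<omega>))"
    and neg: "expectation (\<lambda>\<omega>. f (\<lambda>i. X i \<omega>)) < 0"
  shows "AE \<omega> in M. bdd_above (range (\<lambda>n. \<Sum>j<n. f (\<lambda>i. X (j + i) \<omega>)))"
proof -
  let ?P = "PiM UNIV (\<lambda>_. D)"
  let ?T = "\<lambda>\<omega> i. X i \<omega>"
  \<comment> \<open>Unboundedness is phrased with quantifiers over naturals, so that
    \<open>E\<close> is a countable combination of measurable sets; \<open>unbdd\<close> translates
    it back to \<open>bdd_above\<close>.\<close>
  define E where "E = {w \<in> space ?P. \<forall>c::nat. \<exists>n. real c < (\<Sum>j<n. f (\<lambda>i. w (j + i)))}"
  have fs: "(\<lambda>w. f (\<lambda>i. w (j + i))) \<in> borel_measurable ?P" for j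
    by (rule measurable_compose[OF measurable_shift f])
  have E: "E \<in> sets ?P"
    unfolding E_def using fs by measurable
  have sp: "\<omega> \<in> space M \<Longrightarrow> (\<lambda>i. X (m + i) \<omega>) \<in> space ?P" for m \<omega>
    using measurable_space[OF measurable_tail] .
  have unbdd: "(\<lambda>i. X (m + i) \<omega>) \<in> E \<longleftrightarrow>
      \<not> bdd_above (range (\<lambda>n. \<Sum>j<n. f (\<lambda>i. X (m + (j + i)) \<omega>)))"
    if "\<omega> \<in> space M" for m \<omega>
  proof -
    have "(\<forall>c::nat. \<exists>n. real c < s n) \<longleftrightarrow> \<not> bdd_above (range s)" for s :: "nat \<Rightarrow> real"
    proof
      assume s: "\<forall>c::nat. \<exists>n. real c < s n"
      show "\<not> bdd_above (range s)"
      proof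
        assume "bdd_above (range s)"
        then obtain b where b: "\<And>n. s n \<le> b" by (auto simp: bdd_above_def)
        from s obtain n where "real (nat \<lceil>b\<rceil>) < s n" by blast
        with b[of n] show False by linarith
      qed
    next
      assume nb: "\<not> bdd_above (range s)"
      show "\<forall>c::nat. \<exists>n. real c < s n"
      proof (rule ccontr)
        assume "\<not> ?thesis"
        then obtain c :: nat where "\<And>n. s n \<le> real c" by (auto simp: not_less)
        then have "bdd_above (range s)" by (rule bdd_aboveI2)
        with nb show False ..
      qed
    qed
    then show ?thesis
      using sp[OF that, of m] by (simp add: E_def)
  qed
  \<comment> \<open>Dropping the first summand shifts all later sums by one constant, so boundedness
    is unaffected; this yields the invariance of \<open>E\<close>.\<close>
  have "bdd_above (range (\<lambda>n. \<Sum>j<n. f (\<lambda>i. X (m + (j + i)) \<omega>)))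
      \<longleftrightarrow> bdd_above (range (\<lambda>n. \<Sum>j<n. f (\<lambda>i. X (Suc m + (j + i)) \<omega>)))" for m \<omega>
  proof -
    let ?s = "\<lambda>n. \<Sum>j<n. f (\<lambda>i. X (m + (j + i)) \<omega>)"
    let ?t = "\<lambda>n. \<Sum>j<n. f (\<lambda>i. X (Suc m + (j + i)) \<omega>)"
    let ?c = "f (\<lambda>i. X (m + i) \<omega>)"
    have st: "?s (Suc n) = ?c + ?t n" for n
      by (subst sum.lessThan_Suc_shift) simp
    show ?thesis
    proof
      assume "bdd_above (range ?s)"
      then obtain b where b: "\<And>n. ?s n \<le> b" by (auto simp: bdd_above_def)
      have "?t n \<le> b - ?c" for n using b[of "Suc n"] st[of n] by linarith
      then show "bdd_above (range ?t)" by (rule bdd_aboveI2)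
    next
      assume "bdd_above (range ?t)"
      then obtain b where b: "\<And>n. ?t n \<le> b" by (auto simp: bdd_above_def)
      \<comment> \<open>The \<open>max 0\<close> accounts for the empty sum, which is no shifted
        copy of any \<open>?t n\<close>.\<close>
      have "?s n \<le> max 0 (?c + b)" for n
      proof (cases n)
        case (Suc k)
        then show ?thesis using b[of k] st[of k] by (simp del: sum.lessThan_Suc)
      qed simp
      then show "bdd_above (range ?s)" by (rule bdd_aboveI2)
    qed
  qed
  then have step: "(\<lambda>i. X (m + i) \<omega>) \<in> E \<longleftrightarrow> (\<lambda>i. X (Suc m + i) \<omega>) \<in> E"
    if "\<omega> \<in> space M" for m \<omega>
    unfolding unbdd[OF that] by (rule arg_cong)
  have inv: "(\<lambda>i. X (m + i) \<omega>) \<in> E \<longleftrightarrow> ?T \<omega> \<in> E" if "\<omega> \<in> space M" for m \<omega>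
    by (induction m) (use step[OF that] in simp_all)
  let ?F = "\<lambda>n \<omega>. partial_max f n (?T \<omega>)"
  let ?F' = "\<lambda>n \<omega>. partial_max f n (\<lambda>i. X (Suc i) \<omega>)"
  let ?g = "\<lambda>n \<omega>. max (- ?F' n \<omega>) (f (?T \<omega>))"
  have intF: "integrable M (?F n)" for n
    by (rule integrable_partial_max[OF f int])
  have intF': "integrable M (?F' n)" for n
    using integrable_tail[OF measurable_partial_max[OF f], of n 1] intF[of n] by simp
  have "expectation (?F' n) = expectation (?F n)" for n
    using integral_tail[OF measurable_partial_max[OF f], of n 1] by simp
  moreover have "?g n \<omega> = ?F (Suc n) \<omega> - ?F' n \<omega>" for n \<omega>
    by (simp add: max_def)
  moreover have "expectation (?F n) \<le> expectation (?F (Suc n))" for n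
    by (intro integral_mono intF partial_max_Suc_ge)
  ultimately have g_nonneg: "0 \<le> expectation (?g n)" for n
    using intF[of "Suc n"] intF'[of n] by (simp del: partial_max.simps)
  have "prob {\<omega> \<in> space M. ?T \<omega> \<in> E} \<noteq> 1"
  proof
    assume "prob {\<omega> \<in> space M. ?T \<omega> \<in> E} = 1"
    then have AE_E: "AE \<omega> in M. ?T \<omega> \<in> E"
      using measurable_sets[OF measurable_tail[of 0] E]
      by (subst (asm) prob_eq_1) (auto simp: vimage_def Int_def conj_commute)
    have "(\<lambda>n. expectation (?g n)) \<longlonglongrightarrow> expectation (\<lambda>\<omega>. f (?T \<omega>))"
    proof (rule integral_dominated_convergence[where w = "\<lambda>\<omega>. \<bar>f (?T \<omega>)\<bar>"])
      show "AE \<omega> in M. (\<lambda>n. ?g n \<omega>) \<longlonglongrightarrow> f (?T \<omega>)"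
        using AE_E AE_space
      proof eventually_elim
        case (elim \<omega>)
        \<comment> \<open>By invariance the sums starting at index 1 are unbounded as well, so some
          \<open>?F' n0\<close> exceeds \<open>- f (?T \<omega>)\<close>. From \<open>n0\<close> on
          the maximum in \<open>?g\<close> is attained by \<open>f\<close>, and the sequence is
          eventually constant.\<close>
        then have "(\<lambda>i. X (1 + i) \<omega>) \<in> E" using inv by blast
        then obtain n0 where "real (nat \<lceil>- f (?T \<omega>)\<rceil>) < (\<Sum>j<n0. f (\<lambda>i. X (Suc (j + i)) \<omega>))"
          by (auto simp: E_def)
        also have "\<dots> \<le> ?F' n0 \<omega>"
          using sum_le_partial_max[of f "\<lambda>i. X (Suc i) \<omega>" n0] by simp
        finally have "- f (?T \<omega>) \<le> ?F' n0 \<omega>"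
          by linarith
        then have "?g n \<omega> = f (?T \<omega>)" if "n \<ge> n0" for n
          using partial_max_mono[OF that, of f "\<lambda>i. X (Suc i) \<omega>"] by simp
        then show ?case
          by (intro tendsto_eventually eventually_sequentiallyI[of n0])
      qed
      \<comment> \<open>Since \<open>?F' n\<close> is nonnegative, \<open>?g n\<close> is either
        \<open>f\<close> itself or a nonpositive number above \<open>f\<close>; in both cases its
        modulus is at most that of \<open>f\<close>.\<close>
      show "AE \<omega> in M. norm (?g n \<omega>) \<le> \<bar>f (?T \<omega>)\<bar>" for n
      proof (rule AE_I2)
        fix \<omega>
        show "norm (?g n \<omega>) \<le> \<bar>f (?T \<omega>)\<bar>"
          using partial_max_nonneg[of f n "\<lambda>i. X (Suc i) \<omega>"]
          unfolding real_norm_def by linarith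
      qed
      show "?g n \<in> borel_measurable M" for n
        using borel_measurable_integrable[OF int] borel_measurable_integrable[OF intF'[of n]]
        by (intro borel_measurable_max borel_measurable_uminus)
      show "(\<lambda>\<omega>. f (?T \<omega>)) \<in> borel_measurable M"
        by (rule borel_measurable_integrable[OF int])
      show "integrable M (\<lambda>\<omega>. \<bar>f (?T \<omega>)\<bar>)"
        using int by (rule integrable_abs)
    qed
    then have "0 \<le> expectation (\<lambda>\<omega>. f (?T \<omega>))"
      by (rule LIMSEQ_le_const) (use g_nonneg in auto)
    with neg show False
      by simp
  qed
  with zero_one_shift_invariant[OF E inv] have "prob {\<omega> \<in> space M. ?T \<omega> \<in> E} = 0"
    by simp
  then have "AE \<omega> in M. ?T \<omega> \<notin> E"
    using measurable_sets[OF measurable_tail[of 0] E]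
    by (subst (asm) prob_eq_0) (auto simp: vimage_def Int_def conj_commute)
  then show ?thesis
    using AE_space
    by eventually_elim (use unbdd[of _ 0] in simp)
qed

text \<open>Subtracting the mean plus \<open>1 / Suc m\<close> leaves a function of strictly
  negative mean, whose sums are almost surely bounded above; the bound divided by \<open>n\<close>
  vanishes. Using only the countably many slacks \<open>1 / Suc m\<close> gives one null set for all
  \<open>e\<close>.\<close>

lemma AE_mean_le:
  fixes f :: "(nat \<Rightarrow> 'b) \<Rightarrow> real"
  assumes f: "f \<in> borel_measurable (PiM UNIV (\<lambda>_. D))"
    and int: "integrable M (\<lambda>\<omega>. f (\<lambda>i. X i \<omega>))"
  shows "AE \<omega> in M. \<forall>e>0. \<forall>\<^sub>F n in sequentially.
    (\<Sum>j<n. f (\<lambda>i. X (j + i) \<omega>)) / n < expectation (\<lambda>\<omega>. f (\<lambda>i. X i \<omega>)) + e"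
proof -
  let ?e = "expectation (\<lambda>\<omega>. f (\<lambda>i. X i \<omega>))"
  have "AE \<omega> in M. bdd_above (range (\<lambda>n. \<Sum>j<n. f (\<lambda>i. X (j + i) \<omega>) - (?e + 1 / Suc m)))"
    for m :: nat
    using f int by (intro AE_bdd_above_sums) (auto simp: prob_space)
  then have "AE \<omega> in M. \<forall>m::nat.
      bdd_above (range (\<lambda>n. \<Sum>j<n. f (\<lambda>i. X (j + i) \<omega>) - (?e + 1 / Suc m)))"
    by (subst AE_all_countable) blast
  then show ?thesis
  proof eventually_elim
    case (elim \<omega>)
    let ?S = "\<lambda>n. \<Sum>j<n. f (\<lambda>i. X (j + i) \<omega>)"
    show ?case
    proof (intro allI impI)
      fix e :: real assume "e > 0"
      then obtain m :: nat where m: "1 / Suc m < e"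
        using reals_Archimedean by (auto simp: inverse_eq_divide)
      from elim obtain b where b: "\<And>n. ?S n - n * (?e + 1 / Suc m) \<le> b"
        by (auto simp: bdd_above_def sum_subtractf)
      have "(\<lambda>n. b / real n) \<longlonglongrightarrow> 0"
        by (rule lim_const_over_n)
      then have "\<forall>\<^sub>F n in sequentially. b / real n < e - 1 / Suc m"
        by (rule order_tendstoD) (use m in simp)
      then show "\<forall>\<^sub>F n in sequentially. ?S n / n < ?e + e"
        using eventually_gt_at_top[of "0::nat"]
      proof eventually_elim
        case (elim n)
        have "?S n / n \<le> (b + n * (?e + 1 / Suc m)) / n"
          by (intro divide_right_mono) (use b[of n] in \<open>auto simp: algebra_simps\<close>)
        also have "\<dots> = b / n + (?e + 1 / Suc m)"
          using elim by (simp add: add_divide_distrib)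
        finally show ?case
          using elim by linarith
      qed
    qed
  qed
qed

text \<open>The one-sided estimate for \<open>f\<close> and for \<open>- f\<close> gives the two
  halves. As \<open>f\<close> sees the whole shifted sequence, overlapping summands such as ratios
  of neighbours are covered.\<close>

theorem strong_law:
  fixes f :: "(nat \<Rightarrow> 'b) \<Rightarrow> real"
  assumes f: "f \<in> borel_measurable (PiM UNIV (\<lambda>_. D))"
    and int: "integrable M (\<lambda>\<omega>. f (\<lambda>i. X i \<omega>))"
  shows "AE \<omega> in M. (\<lambda>n. (\<Sum>j<n. f (\<lambda>i. X (j + i) \<omega>)) / n)
    \<longlonglongrightarrow> expectation (\<lambda>\<omega>. f (\<lambda>i. X i \<omega>))"
proof -
  have "AE \<omega> in M. \<forall>e>0. \<forall>\<^sub>F n in sequentially.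
    (\<Sum>j<n. - f (\<lambda>i. X (j + i) \<omega>)) / n < expectation (\<lambda>\<omega>. - f (\<lambda>i. X i \<omega>)) + e"
    using f int by (intro AE_mean_le) auto
  with AE_mean_le[OF f int] show ?thesis
  proof eventually_elim
    case (elim \<omega>)
    show ?case
    proof (rule tendstoI)
      fix e :: real assume "e > 0"
      with elim have
        "\<forall>\<^sub>F n in sequentially. (\<Sum>j<n. f (\<lambda>i. X (j + i) \<omega>)) / n
          < expectation (\<lambda>\<omega>. f (\<lambda>i. X i \<omega>)) + e"
        "\<forall>\<^sub>F n in sequentially. (\<Sum>j<n. - f (\<lambda>i. X (j + i) \<omega>)) / n
          < expectation (\<lambda>\<omega>. - f (\<lambda>i. X i \<omega>)) + e"
        by blast+
      then show "\<forall>\<^sub>F n in sequentially. dist ((\<Sum>j<n. f (\<lambda>i. X (j + i) \<omega>)) / n)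
          (expectation (\<lambda>\<omega>. f (\<lambda>i. X i \<omega>))) < e"
        by eventually_elim (auto simp: dist_real_def sum_negf abs_less_iff)
    qed
  qed
qed

end

subsection \<open>Matrix norms and rank-one matrices\<close>

text \<open>Equivalence of norms in finite dimension: a basis expansion gives \<open>C\<close>,
  hence Lipschitz continuity, and the minimum over the compact unit sphere gives \<open>c\<close>.
  Continuity is exported because measurability of the norm rests on it.\<close>

lemma matrix_norm_bounds:
  fixes N :: "real^'n^'n \<Rightarrow> real"
  assumes N: "matrix_norm N"
  obtains c C where "0 < c" "0 < C" "\<And>A. c * norm A \<le> N A" "\<And>A. N A \<le> C * norm A"
    "continuous_on UNIV N"
proof -
  have nonneg: "0 \<le> N A" and zero: "N A = 0 \<longleftrightarrow> A = 0" and scale: "N (r *\<^sub>R A) = \<bar>r\<bar> * N A"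
    and triangle: "N (A + B) \<le> N A + N B" for r A B
    using N by (auto simp: matrix_norm_def)
  \<comment> \<open>The summand 1 makes \<open>C\<close> strictly positive at once.\<close>
  define C where "C = (\<Sum>b\<in>Basis. N b) + 1"
  have "0 < C"
    using nonneg by (auto simp: C_def intro!: add_nonneg_pos sum_nonneg)
  have sum: "N (\<Sum>i\<in>I. g i) \<le> (\<Sum>i\<in>I. N (g i))" if "finite I" for I and g :: "real^'n^'n \<Rightarrow> real^'n^'n"
    using that
  proof induction
    case empty
    then show ?case using zero[of 0] by simp
  next
    case (insert i I)
    then show ?case using triangle[of "g i" "\<Sum>i\<in>I. g i"] by simp
  qed
  have upper: "N A \<le> C * norm A" for A
  proof -
    have "N A = N (\<Sum>b\<in>Basis. (A \<bullet> b) *\<^sub>R b)"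
      by (simp add: euclidean_representation)
    also have "\<dots> \<le> (\<Sum>b\<in>Basis. N ((A \<bullet> b) *\<^sub>R b))"
      by (rule sum) simp
    also have "\<dots> \<le> (\<Sum>b\<in>Basis. norm A * N b)"
      unfolding scale by (intro sum_mono mult_right_mono Basis_le_norm nonneg)
    also have "\<dots> \<le> C * norm A"
      by (simp add: C_def sum_distrib_left[symmetric] distrib_right mult.commute[of _ "norm A"] distrib_left)
    finally show ?thesis .
  qed
  have diff: "\<bar>N A - N B\<bar> \<le> C * norm (A - B)" for A B
  proof -
    have "N (B - A) = N (A - B)"
      using scale[of "-1" "A - B"] by simp
    then show ?thesis
      using triangle[of "A - B" B] triangle[of "B - A" A] upper[of "A - B"] by simp
  qed
  have "C-lipschitz_on UNIV N"
    using diff \<open>0 < C\<close> by (intro lipschitz_onI) (auto simp: dist_norm)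
  then have cont: "continuous_on UNIV N"
    by (rule lipschitz_on_continuous_on)
  have "compact (sphere (0::real^'n^'n) 1)" "sphere (0::real^'n^'n) 1 \<noteq> {}"
    by auto
  then obtain A0 where A0: "A0 \<in> sphere 0 1" "\<And>A. A \<in> sphere 0 1 \<Longrightarrow> N A0 \<le> N A"
    using continuous_attains_inf[of "sphere 0 1" N] continuous_on_subset[OF cont] by auto
  have "0 < N A0"
    using A0(1) zero[of A0] nonneg[of A0] by (auto simp: less_le)
  moreover have "N A0 * norm A \<le> N A" for A
  proof (cases "A = 0")
    case False
    have "N A0 \<le> N ((1 / norm A) *\<^sub>R A)"
      using False by (intro A0(2)) simp
    also have "\<dots> = N A / norm A"
      by (simp add: scale)
    finally show ?thesis
      using False by (simp add: field_simps)
  qed (simp add: nonneg)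
  ultimately show thesis
    using that \<open>0 < C\<close> upper cont by blast
qed

text \<open>The outer product of the column (1, 1/b) and the row (1, a). Multiplying on the left
  keeps the row, so \<open>a\<close> stays at the first variable while \<open>b\<close> follows the
  latest one.\<close>

definition rank_one_mat :: "real \<Rightarrow> real \<Rightarrow> real^2^2" where
  "rank_one_mat a b = vector [vector [1, a], vector [1 / b, a / b]]"

text \<open>Constant matrices with scalar coefficients: a form from which measurability of the
  matrix-valued map can be read off.\<close>

lemma rank_one_mat_eq_sum:
  "rank_one_mat a b = vector [vector [1, 0], vector [0, 0]] + a *\<^sub>R vector [vector [0, 1], vector [0, 0]]
    + (1 / b) *\<^sub>R vector [vector [0, 0], vector [1, 0]] + (a / b) *\<^sub>R vector [vector [0, 0], vector [0, 1]]"
  by (simp add: rank_one_mat_def vec_eq_iff forall_2)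

lemma Y_mat_eq_rank_one_mat: "t \<noteq> 0 \<Longrightarrow> Y_mat t = rank_one_mat t t"
  by (simp add: rank_one_mat_def Y_mat_def)

text \<open>\<open>Y_mat t\<close> is the column (1, 1/t) times the row (1, t); the scalar is this
  row applied to the column (1, 1/b).\<close>

lemma Y_mat_mult_rank_one_mat:
  "t \<noteq> 0 \<Longrightarrow> b \<noteq> 0 \<Longrightarrow> Y_mat t ** rank_one_mat a b = (1 + t / b) *\<^sub>R rank_one_mat a t"
  by (simp add: rank_one_mat_def Y_mat_def vec_eq_iff forall_2 matrix_matrix_mult_def sum_2 field_simps)

lemma norm_rank_one_mat_ge: "1 \<le> norm (rank_one_mat a b)"
proof -
  have "1 = \<bar>rank_one_mat a b $ 1 $ 1\<bar>"
    by (simp add: rank_one_mat_def)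
  also have "\<dots> \<le> norm (rank_one_mat a b $ 1)"
    by (rule component_le_norm_cart)
  also have "\<dots> \<le> norm (rank_one_mat a b)"
    by (rule Finite_Cartesian_Product.norm_nth_le)
  finally show ?thesis .
qed

text \<open>The sum of the absolute entries of an outer product factors, so the logarithm separates
  the first variable from the last.\<close>

lemma norm_rank_one_mat_le: "norm (rank_one_mat a b) \<le> (1 + \<bar>a\<bar>) * (1 + 1 / \<bar>b\<bar>)"
proof -
  have "norm (rank_one_mat a b) \<le> (\<Sum>i\<in>UNIV. norm (rank_one_mat a b $ i))"
    unfolding norm_vec_def by (rule L2_set_le_sum) simp
  also have "\<dots> \<le> (\<Sum>i\<in>UNIV. \<Sum>j\<in>UNIV. \<bar>rank_one_mat a b $ i $ j\<bar>)"
    by (intro sum_mono norm_le_l1_cart)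
  also have "\<dots> = (1 + \<bar>a\<bar>) * (1 + 1 / \<bar>b\<bar>)"
    by (simp add: rank_one_mat_def sum_2 distrib_left distrib_right add_divide_distrib)
  finally show ?thesis .
qed

lemma partial_product_Y_mat:
  assumes "\<And>j. x (Suc j) \<omega> \<noteq> 0"
  shows "partial_product (\<lambda>j \<omega>. Y_mat (x j \<omega>)) (Suc n) \<omega>
    = (\<Prod>j<n. 1 + x (Suc (Suc j)) \<omega> / x (Suc j) \<omega>) *\<^sub>R rank_one_mat (x 1 \<omega>) (x (Suc n) \<omega>)"
proof (induction n)
  case 0
  then show ?case
    using assms[of 0] by (simp add: Y_mat_eq_rank_one_mat)
next
  case (Suc n)
  have "partial_product (\<lambda>j \<omega>. Y_mat (x j \<omega>)) (Suc (Suc n)) \<omega>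
     = Y_mat (x (Suc (Suc n)) \<omega>) ** partial_product (\<lambda>j \<omega>. Y_mat (x j \<omega>)) (Suc n) \<omega>"
    by simp
  also have "\<dots> = (\<Prod>j<n. 1 + x (Suc (Suc j)) \<omega> / x (Suc j) \<omega>) *\<^sub>R
      (Y_mat (x (Suc (Suc n)) \<omega>) ** rank_one_mat (x 1 \<omega>) (x (Suc n) \<omega>))"
    unfolding Suc by (simp add: matrix_matrix_mult_def vec_eq_iff sum_distrib_left mult.left_commute)
  also have "\<dots> = (\<Prod>j<Suc n. 1 + x (Suc (Suc j)) \<omega> / x (Suc j) \<omega>) *\<^sub>R
      rank_one_mat (x 1 \<omega>) (x (Suc (Suc n)) \<omega>)"
    using assms[of n] assms[of "Suc n"] by (simp add: Y_mat_mult_rank_one_mat)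
  finally show ?case .
qed

subsection \<open>Extended expectations\<close>

lemma measurable_elog [measurable]: "elog \<in> borel_measurable borel"
  unfolding elog_def by measurable

lemma ext_expectation_cong:
  assumes "\<And>\<omega>. \<omega> \<in> space M \<Longrightarrow> F \<omega> = G \<omega>"
  shows "ext_expectation M F = ext_expectation M G"
    and "has_ext_expectation M F = has_ext_expectation M G"
proof -
  have "(\<integral>\<^sup>+\<omega>. e2ennreal (F \<omega>) \<partial>M) = (\<integral>\<^sup>+\<omega>. e2ennreal (G \<omega>) \<partial>M)"
    "(\<integral>\<^sup>+\<omega>. e2ennreal (- F \<omega>) \<partial>M) = (\<integral>\<^sup>+\<omega>. e2ennreal (- G \<omega>) \<partial>M)"
    by (rule nn_integral_cong, simp add: assms)+
  moreover have "F \<in> borel_measurable M \<longleftrightarrow> G \<in> borel_measurable M"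
    by (rule measurable_cong) (rule assms)
  ultimately show "ext_expectation M F = ext_expectation M G"
    "has_ext_expectation M F = has_ext_expectation M G"
    by (simp_all add: ext_expectation_def has_ext_expectation_def)
qed

lemma has_ext_expectation_upper:
  assumes "F \<in> borel_measurable M" "integrable M u" "\<And>\<omega>. \<omega> \<in> space M \<Longrightarrow> F \<omega> \<le> ereal (u \<omega>)"
  shows "has_ext_expectation M F" "(\<integral>\<^sup>+\<omega>. e2ennreal (F \<omega>) \<partial>M) < \<infinity>"
proof -
  have "(\<integral>\<^sup>+\<omega>. e2ennreal (F \<omega>) \<partial>M) \<le> (\<integral>\<^sup>+\<omega>. ennreal \<bar>u \<omega>\<bar> \<partial>M)"
  proof (rule nn_integral_mono)
    fix \<omega> assume "\<omega> \<in> space M"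
    then have "F \<omega> \<le> ereal \<bar>u \<omega>\<bar>"
      using assms(3)[of \<omega>] order_trans[of "F \<omega>" "ereal (u \<omega>)" "ereal \<bar>u \<omega>\<bar>"] by simp
    from e2ennreal_mono[OF this] show "e2ennreal (F \<omega>) \<le> ennreal \<bar>u \<omega>\<bar>"
      by simp
  qed
  also have "\<dots> < \<infinity>"
    using assms(2) by (auto simp: integrable_iff_bounded)
  finally show "(\<integral>\<^sup>+\<omega>. e2ennreal (F \<omega>) \<partial>M) < \<infinity>" .
  then show "has_ext_expectation M F"
    using assms(1) by (simp add: has_ext_expectation_def)
qed

lemma ext_expectation_eq_integral:
  assumes f: "integrable M f" and eq: "AE \<omega> in M. F \<omega> = ereal (f \<omega>)"
  shows "ext_expectation M F = ereal (integral\<^sup>L M f)"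
proof -
  have "(\<integral>\<^sup>+\<omega>. e2ennreal (F \<omega>) \<partial>M) = (\<integral>\<^sup>+\<omega>. ennreal (f \<omega>) \<partial>M)"
    "(\<integral>\<^sup>+\<omega>. e2ennreal (- F \<omega>) \<partial>M) = (\<integral>\<^sup>+\<omega>. ennreal (- f \<omega>) \<partial>M)"
    by (rule nn_integral_cong_AE, use eq in eventually_elim, simp)+
  moreover from f obtain r q where "0 \<le> r" "0 \<le> q"
      "(\<integral>\<^sup>+\<omega>. ennreal (f \<omega>) \<partial>M) = ennreal r" "(\<integral>\<^sup>+\<omega>. ennreal (- f \<omega>) \<partial>M) = ennreal q"
      "integral\<^sup>L M f = r - q"
    by (rule integrableE)
  ultimately show ?thesis
    by (simp add: ext_expectation_def enn2ereal_ennreal)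
qed

text \<open>From \<open>- G \<le> - F + u\<close> with \<open>u\<close> integrable, an infinite
  negative part of \<open>G\<close> forces one for \<open>F\<close>. The finite positive part of
  \<open>F\<close> rules out the ambiguous difference of two infinities.\<close>

lemma ext_expectation_eq_MInfty:
  assumes F: "F \<in> borel_measurable M" and G: "G \<in> borel_measurable M"
    and u: "integrable M u" and FG: "\<And>\<omega>. \<omega> \<in> space M \<Longrightarrow> F \<omega> \<le> G \<omega> + ereal (u \<omega>)"
    and pos: "(\<integral>\<^sup>+\<omega>. e2ennreal (F \<omega>) \<partial>M) < \<infinity>"
    and neg: "(\<integral>\<^sup>+\<omega>. e2ennreal (- G \<omega>) \<partial>M) = \<infinity>"
  shows "ext_expectation M F = -\<infinity>"
proof -
  have "e2ennreal (- G \<omega>) \<le> e2ennreal (- F \<omega>) + ennreal \<bar>u \<omega>\<bar>" if "\<omega> \<in> space M" for \<omega>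
  proof -
    have "- G \<omega> \<le> - F \<omega> + ereal (u \<omega>)"
      using FG[OF that] by (cases "F \<omega>"; cases "G \<omega>") auto
    \<comment> \<open>Negative values are cut off first, because \<open>e2ennreal\<close> is
      additive only on nonnegative arguments.\<close>
    also have "\<dots> \<le> max 0 (- F \<omega>) + ereal \<bar>u \<omega>\<bar>"
      by (intro add_mono) auto
    finally have "e2ennreal (- G \<omega>) \<le> e2ennreal (max 0 (- F \<omega>) + ereal \<bar>u \<omega>\<bar>)"
      by (rule e2ennreal_mono)
    also have "\<dots> = e2ennreal (max 0 (- F \<omega>)) + e2ennreal (ereal \<bar>u \<omega>\<bar>)"
      by (simp add: enn2ereal_inject[symmetric] plus_ennreal.rep_eq enn2ereal_e2ennreal
          del: e2ennreal_ereal)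
    also have "e2ennreal (max 0 (- F \<omega>)) = e2ennreal (- F \<omega>)"
      by (simp add: max_def e2ennreal_neg)
    finally show ?thesis
      by simp
  qed
  then have "(\<integral>\<^sup>+\<omega>. e2ennreal (- G \<omega>) \<partial>M)
      \<le> (\<integral>\<^sup>+\<omega>. (e2ennreal (- F \<omega>) + ennreal \<bar>u \<omega>\<bar>) \<partial>M)"
    by (rule nn_integral_mono)
  also have "\<dots> = (\<integral>\<^sup>+\<omega>. e2ennreal (- F \<omega>) \<partial>M) + (\<integral>\<^sup>+\<omega>. ennreal \<bar>u \<omega>\<bar> \<partial>M)"
    using F u by (intro nn_integral_add) auto
  finally have "(\<integral>\<^sup>+\<omega>. e2ennreal (- F \<omega>) \<partial>M) + (\<integral>\<^sup>+\<omega>. ennreal \<bar>u \<omega>\<bar> \<partial>M) = \<infinity>"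
    using neg by (simp add: top_unique)
  moreover have "(\<integral>\<^sup>+\<omega>. ennreal \<bar>u \<omega>\<bar> \<partial>M) < \<infinity>"
    using u by (auto simp: integrable_iff_bounded)
  ultimately have "(\<integral>\<^sup>+\<omega>. e2ennreal (- F \<omega>) \<partial>M) = \<infinity>"
    by auto
  moreover obtain r where "(\<integral>\<^sup>+\<omega>. e2ennreal (F \<omega>) \<partial>M) = ennreal r" "0 \<le> r"
    using pos by (cases "\<integral>\<^sup>+\<omega>. e2ennreal (F \<omega>) \<partial>M") auto
  ultimately show ?thesis
    by (simp add: ext_expectation_def enn2ereal_ennreal)
qed

subsection \<open>Growth of products of rank-one matrices\<close>

text \<open>Both terms on the right have finite mean under the moment conditions, hence so has the
  positive part of the log-ratio.\<close>

lemma ln_abs_one_plus_divide_le: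
  fixes a b :: real
  assumes "1 + b / a \<noteq> 0"
  shows "ln \<bar>1 + b / a\<bar> \<le> ln (1 + \<bar>b\<bar>) + ln (1 + 1 / \<bar>a\<bar>)"
proof -
  have "\<bar>1 + b / a\<bar> \<le> 1 + \<bar>b\<bar> / \<bar>a\<bar>"
    by (metis abs_divide abs_one abs_triangle_ineq)
  also have "\<dots> \<le> (1 + \<bar>b\<bar>) * (1 + 1 / \<bar>a\<bar>)"
    by (simp add: distrib_left distrib_right add_divide_distrib)
  finally have "ln \<bar>1 + b / a\<bar> \<le> ln ((1 + \<bar>b\<bar>) * (1 + 1 / \<bar>a\<bar>))"
    using assms by (intro ln_mono) auto
  also have "\<dots> = ln (1 + \<bar>b\<bar>) + ln (1 + 1 / \<bar>a\<bar>)"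
    by (rule ln_mult_pos) (auto intro: add_pos_nonneg)
  finally show ?thesis .
qed

text \<open>A product of \<open>n + 1\<close> matrices carries only \<open>n\<close> ratios, so sums
  of \<open>n\<close> terms get divided by \<open>n + 1\<close>.\<close>

lemma tendsto_mean_Suc:
  fixes a :: "nat \<Rightarrow> real"
  assumes "(\<lambda>n. a n / real n) \<longlonglongrightarrow> l"
  shows "(\<lambda>n. a n / real (Suc n)) \<longlonglongrightarrow> l"
proof -
  have "(\<lambda>n. (a n / real n) * (real n / real (Suc n))) \<longlonglongrightarrow> l"
    by (rule tendsto_eq_rhs[OF _ mult_1_right], intro tendsto_mult assms LIMSEQ_n_over_Suc_n)
  moreover have "\<forall>\<^sub>F n in sequentially. (a n / real n) * (real n / real (Suc n)) = a n / real (Suc n)"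
    using eventually_gt_at_top[of 0] by eventually_elim (simp del: of_nat_Suc)
  ultimately show ?thesis
    by (auto elim: Lim_transform_eventually)
qed

text \<open>The logarithm of \<open>\<bar>r\<bar>\<close> cut off at \<open>- K\<close>, with \<open>log 0 = -\<infinity>\<close> instead of the library's \<open>ln 0 = 0\<close>.\<close>

definition log_trunc :: "real \<Rightarrow> real \<Rightarrow> real" where
  "log_trunc K r = (if r = 0 then - K else max (- K) (ln \<bar>r\<bar>))"

lemma measurable_log_trunc [measurable]: "log_trunc K \<in> borel_measurable borel"
  unfolding log_trunc_def by measurable

lemma elog_le_log_trunc: "elog \<bar>r\<bar> \<le> ereal (log_trunc K r)"
  by (simp add: elog_def log_trunc_def)

lemma log_trunc_antimono: "K \<le> K' \<Longrightarrow> log_trunc K' r \<le> log_trunc K r"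
  by (auto simp: log_trunc_def)

text \<open>\<open>log_trunc 0\<close> is the positive part of the logarithm; only the subtracted
  term depends on \<open>K\<close>, and it increases with \<open>K\<close>, ready for monotone
  convergence.\<close>

lemma log_trunc_split:
  assumes "0 \<le> K"
  shows "log_trunc K r = log_trunc 0 r - max 0 (- log_trunc K r)"
proof -
  have "max (- K) l = max (- 0) l - max 0 (- max (- K) l)" for l
    using assms by linarith
  with assms show ?thesis
    by (cases "r = 0") (simp_all only: log_trunc_def if_True if_False, simp)
qed

lemma elog_mult_pos:
  assumes "0 < q"
  shows "elog (\<bar>p\<bar> * q) = elog \<bar>p\<bar> + ereal (ln q)"
  using assms by (simp add: elog_def ln_mult)

lemma elog_abs_prod:
  assumes "\<And>i. i \<in> I \<Longrightarrow> r i \<noteq> 0" "finite I"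
  shows "elog \<bar>\<Prod>i\<in>I. r i\<bar> = ereal (\<Sum>i\<in>I. ln \<bar>r i\<bar>)"
  using assms by (simp add: elog_def abs_prod ln_prod)

text \<open>An upper bound that survives vanishing factors: the left side is then -\<infinity> while
  the right side stays real.\<close>

lemma elog_abs_prod_le:
  assumes "finite I"
  shows "elog \<bar>\<Prod>i\<in>I. r i\<bar> \<le> ereal (\<Sum>i\<in>I. log_trunc K (r i))"
proof (cases "\<exists>i\<in>I. r i = 0")
  case True
  then have "(\<Prod>i\<in>I. r i) = 0"
    using assms by auto
  then show ?thesis
    by (simp add: elog_def)
next
  case False
  then have "elog \<bar>\<Prod>i\<in>I. r i\<bar> = ereal (\<Sum>i\<in>I. ln \<bar>r i\<bar>)"
    using assms by (intro elog_abs_prod) auto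
  also have "(\<Sum>i\<in>I. ln \<bar>r i\<bar>) \<le> (\<Sum>i\<in>I. log_trunc K (r i))"
    using False by (intro sum_mono) (auto simp: log_trunc_def)
  finally show ?thesis
    by simp
qed

lemma measurable_consecutive_ratio [measurable]:
  "(\<lambda>w. 1 + w 1 / w 0) \<in> borel_measurable (PiM UNIV (\<lambda>_::nat. borel :: real measure))"
  by (intro borel_measurable_add borel_measurable_divide borel_measurable_const
      measurable_component_singleton) auto

text \<open>Indices start at 0: in the theorem \<open>X j\<close> is \<open>x (Suc j)\<close>. Thus
  \<open>growth n\<close> belongs to a product of \<open>n + 1\<close> matrices and is normalised by
  \<open>Suc n\<close>.\<close>

locale rank_one_growth = iid_sequence M borel X
  for M :: "'a measure" and X :: "nat \<Rightarrow> 'a \<Rightarrow> real" +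
  fixes N :: "real^2^2 \<Rightarrow> real"
  assumes nonzero: "\<And>j \<omega>. \<omega> \<in> space M \<Longrightarrow> X j \<omega> \<noteq> 0"
    and moment: "(\<integral>\<^sup>+\<omega>. ennreal (ln (1 + \<bar>X 0 \<omega>\<bar>)) \<partial>M) < \<infinity>"
    and moment_inverse: "(\<integral>\<^sup>+\<omega>. ennreal (ln (1 + 1 / \<bar>X 0 \<omega>\<bar>)) \<partial>M) < \<infinity>"
    and N: "matrix_norm N"
begin

abbreviation ratio :: "nat \<Rightarrow> 'a \<Rightarrow> real" where
  "ratio j \<omega> \<equiv> 1 + X (Suc j) \<omega> / X j \<omega>"

definition boundary :: "nat \<Rightarrow> 'a \<Rightarrow> real" where
  "boundary n \<omega> = ln (N (rank_one_mat (X 0 \<omega>) (X n \<omega>)))"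

text \<open>Built from the telescoped form instead of the matrix product, so that its bounds hold at
  every \<open>\<omega>\<close>; both agree on \<open>space M\<close>, where the variables are
  nonzero.\<close>

definition growth :: "nat \<Rightarrow> 'a \<Rightarrow> ereal" where
  "growth n \<omega> = elog (N ((\<Prod>j<n. ratio j \<omega>) *\<^sub>R rank_one_mat (X 0 \<omega>) (X n \<omega>)))"

lemma N_rank_one_mat_pos: "0 < N (rank_one_mat a b)"
proof -
  have "rank_one_mat a b \<noteq> 0"
    using norm_rank_one_mat_ge[of a b] by auto
  with N show ?thesis
    by (auto simp: matrix_norm_def less_le)
qed

lemma growth_eq: "growth n \<omega> = elog \<bar>\<Prod>j<n. ratio j \<omega>\<bar> + ereal (boundary n \<omega>)"
proof -
  have "growth n \<omega> = elog (\<bar>\<Prod>j<n. ratio j \<omega>\<bar> * N (rank_one_mat (X 0 \<omega>) (X n \<omega>)))"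
    using N by (simp add: growth_def matrix_norm_def)
  then show ?thesis
    by (simp only: elog_mult_pos[OF N_rank_one_mat_pos] boundary_def)
qed

lemma growth_le: "growth n \<omega> \<le> ereal ((\<Sum>j<n. log_trunc K (ratio j \<omega>)) + boundary n \<omega>)"
  unfolding growth_eq plus_ereal.simps(1)[symmetric]
  by (intro add_right_mono elog_abs_prod_le) simp

lemma measurable_boundary [measurable]: "boundary n \<in> borel_measurable M"
proof -
  have "N \<in> borel_measurable borel"
    using matrix_norm_bounds[OF N] by (metis borel_measurable_continuous_onI)
  moreover have "(\<lambda>\<omega>. rank_one_mat (X 0 \<omega>) (X n \<omega>)) \<in> borel_measurable M"
    unfolding rank_one_mat_eq_sum by measurable
  ultimately show ?thesis
    unfolding boundary_def by measurable
qed

lemma measurable_growth [measurable]: "growth n \<in> borel_measurable M"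
  unfolding growth_eq by measurable

section \<open>Size of the boundary term\<close>

lemma integrable_ln_abs: "integrable M (\<lambda>\<omega>. ln (1 + \<bar>X n \<omega>\<bar>))"
proof -
  have "integrable M (\<lambda>\<omega>. ln (1 + \<bar>X 0 \<omega>\<bar>))"
    using moment by (simp add: integrable_iff_bounded)
  then show ?thesis
    using integrable_tail[of "\<lambda>w. ln (1 + \<bar>w 0\<bar>)" n] by simp
qed

lemma integrable_ln_inverse: "integrable M (\<lambda>\<omega>. ln (1 + 1 / \<bar>X n \<omega>\<bar>))"
proof -
  have "integrable M (\<lambda>\<omega>. ln (1 + 1 / \<bar>X 0 \<omega>\<bar>))"
    using moment_inverse by (simp add: integrable_iff_bounded)
  then show ?thesis
    using integrable_tail[of "\<lambda>w. ln (1 + 1 / \<bar>w 0\<bar>)" n] by simp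
qed

text \<open>\<open>B\<close> comes from the norm-equivalence constants and is uniform in
  \<open>n\<close> and \<open>\<omega>\<close>. One remaining term is fixed and the other has a law
  independent of \<open>n\<close>, which gives bounded means and, through the strong law, o(n)
  almost surely.\<close>

lemma boundary_bound:
  obtains B where "0 \<le> B"
    "\<And>n \<omega>. \<bar>boundary n \<omega>\<bar> \<le> B + ln (1 + \<bar>X 0 \<omega>\<bar>) + ln (1 + 1 / \<bar>X n \<omega>\<bar>)"
proof -
  obtain c C where cC: "0 < c" "0 < C" "\<And>A. c * norm A \<le> N A" "\<And>A. N A \<le> C * norm A"
    using matrix_norm_bounds[OF N] by metis
  have "\<bar>boundary n \<omega>\<bar> \<le> \<bar>ln c\<bar> + \<bar>ln C\<bar> + ln (1 + \<bar>X 0 \<omega>\<bar>) + ln (1 + 1 / \<bar>X n \<omega>\<bar>)" for n \<omega>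
  proof -
    let ?R = "rank_one_mat (X 0 \<omega>) (X n \<omega>)"
    have "c * 1 \<le> c * norm ?R"
      using cC(1) norm_rank_one_mat_ge by (intro mult_left_mono) auto
    also have "\<dots> \<le> N ?R"
      by (rule cC)
    finally have "ln c \<le> boundary n \<omega>"
      using cC(1) N_rank_one_mat_pos by (simp add: boundary_def)
    moreover have "boundary n \<omega> \<le> ln (C * ((1 + \<bar>X 0 \<omega>\<bar>) * (1 + 1 / \<bar>X n \<omega>\<bar>)))"
    proof -
      have "N ?R \<le> C * norm ?R"
        by (rule cC)
      also have "\<dots> \<le> C * ((1 + \<bar>X 0 \<omega>\<bar>) * (1 + 1 / \<bar>X n \<omega>\<bar>))"
        using cC(2) norm_rank_one_mat_le by (intro mult_left_mono) auto
      finally show ?thesis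
        unfolding boundary_def using N_rank_one_mat_pos by (intro ln_mono) auto
    qed
    moreover have "ln (C * ((1 + \<bar>X 0 \<omega>\<bar>) * (1 + 1 / \<bar>X n \<omega>\<bar>)))
        = ln C + (ln (1 + \<bar>X 0 \<omega>\<bar>) + ln (1 + 1 / \<bar>X n \<omega>\<bar>))"
    proof -
      have "0 < 1 + \<bar>X 0 \<omega>\<bar>" "0 < 1 + 1 / \<bar>X n \<omega>\<bar>"
        by (auto intro: add_pos_nonneg)
      with cC(2) show ?thesis
        by (simp add: ln_mult_pos)
    qed
    moreover have "0 \<le> ln (1 + \<bar>X 0 \<omega>\<bar>)" "0 \<le> ln (1 + 1 / \<bar>X n \<omega>\<bar>)"
      by auto
    ultimately show ?thesis
      by linarith
  qed
  then show thesis
    by (intro that[of "\<bar>ln c\<bar> + \<bar>ln C\<bar>"]) auto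
qed

lemma integrable_boundary: "integrable M (boundary n)"
proof -
  obtain B where B: "0 \<le> B"
    "\<And>n \<omega>. \<bar>boundary n \<omega>\<bar> \<le> B + ln (1 + \<bar>X 0 \<omega>\<bar>) + ln (1 + 1 / \<bar>X n \<omega>\<bar>)"
    by (rule boundary_bound) blast
  have "integrable M (\<lambda>\<omega>. B + ln (1 + \<bar>X 0 \<omega>\<bar>) + ln (1 + 1 / \<bar>X n \<omega>\<bar>))"
    by (intro Bochner_Integration.integrable_add integrable_const integrable_ln_abs integrable_ln_inverse)
  then show ?thesis
    by (rule Bochner_Integration.integrable_bound)
      (use B in \<open>auto intro!: AE_I2 order_trans[OF _ abs_ge_self]\<close>)
qed

lemma expectation_boundary_tendsto: "(\<lambda>n. expectation (boundary n) / real (Suc n)) \<longlonglongrightarrow> 0"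
proof -
  obtain B where B: "0 \<le> B"
    "\<And>n \<omega>. \<bar>boundary n \<omega>\<bar> \<le> B + ln (1 + \<bar>X 0 \<omega>\<bar>) + ln (1 + 1 / \<bar>X n \<omega>\<bar>)"
    by (rule boundary_bound) blast
  define C where "C = B + expectation (\<lambda>\<omega>. ln (1 + \<bar>X 0 \<omega>\<bar>)) + expectation (\<lambda>\<omega>. ln (1 + 1 / \<bar>X 0 \<omega>\<bar>))"
  have "\<bar>expectation (boundary n)\<bar> \<le> C" for n
  proof -
    have "\<bar>expectation (boundary n)\<bar> \<le> expectation (\<lambda>\<omega>. \<bar>boundary n \<omega>\<bar>)"
      by (rule integral_abs_bound)
    also have "\<dots> \<le> expectation (\<lambda>\<omega>. B + ln (1 + \<bar>X 0 \<omega>\<bar>) + ln (1 + 1 / \<bar>X n \<omega>\<bar>))"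
      using B by (intro integral_mono integrable_abs integrable_boundary
          Bochner_Integration.integrable_add integrable_const integrable_ln_abs integrable_ln_inverse)
    also have "\<dots> = B + expectation (\<lambda>\<omega>. ln (1 + \<bar>X 0 \<omega>\<bar>)) + expectation (\<lambda>\<omega>. ln (1 + 1 / \<bar>X n \<omega>\<bar>))"
      by (simp add: integrable_ln_abs integrable_ln_inverse prob_space)
    also have "\<dots> = C"
      using integral_tail[of "\<lambda>w. ln (1 + 1 / \<bar>w 0\<bar>)" n] by (simp add: C_def)
    finally show ?thesis .
  qed
  then have "norm (expectation (boundary n) / real (Suc n)) \<le> C / real (Suc n)" for n
    by (simp add: divide_right_mono del: of_nat_Suc)
  moreover have "(\<lambda>n. C / real (Suc n)) \<longlonglongrightarrow> 0"
    using LIMSEQ_Suc[OF lim_const_over_n] .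
  ultimately show ?thesis
    by (rule Lim_null_comparison[OF always_eventually[OF allI]])
qed

text \<open>The last term \<open>?k n\<close> divided by \<open>Suc n\<close> is the difference of
  two averages of the \<open>?k j\<close> with the same almost sure limit, so it tends to 0.\<close>

lemma AE_boundary_tendsto: "AE \<omega> in M. (\<lambda>n. boundary n \<omega> / real (Suc n)) \<longlonglongrightarrow> 0"
proof -
  obtain B where B: "0 \<le> B"
    "\<And>n \<omega>. \<bar>boundary n \<omega>\<bar> \<le> B + ln (1 + \<bar>X 0 \<omega>\<bar>) + ln (1 + 1 / \<bar>X n \<omega>\<bar>)"
    by (rule boundary_bound) blast
  let ?k = "\<lambda>n \<omega>. ln (1 + 1 / \<bar>X n \<omega>\<bar>)"
  have "AE \<omega> in M. (\<lambda>n. (\<Sum>j<n. ?k j \<omega>) / n) \<longlonglongrightarrow> expectation (?k 0)"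
    using strong_law[of "\<lambda>w. ln (1 + 1 / \<bar>w 0\<bar>)"] integrable_ln_inverse[of 0] by simp
  then show ?thesis
  proof eventually_elim
    case (elim \<omega>)
    have "(\<lambda>n. (\<Sum>j<Suc n. ?k j \<omega>) / real (Suc n) - (\<Sum>j<n. ?k j \<omega>) / real (Suc n))
        \<longlonglongrightarrow> expectation (?k 0) - expectation (?k 0)"
      by (intro tendsto_diff LIMSEQ_Suc[OF elim] tendsto_mean_Suc[OF elim])
    then have k: "(\<lambda>n. ?k n \<omega> / real (Suc n)) \<longlonglongrightarrow> 0"
      by (simp add: diff_divide_distrib[symmetric])
    let ?b = "B + ln (1 + \<bar>X 0 \<omega>\<bar>)"
    have "(\<lambda>n. ?b / real (Suc n) + ?k n \<omega> / real (Suc n)) \<longlonglongrightarrow> 0 + 0"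
      by (intro tendsto_add k LIMSEQ_Suc[OF lim_const_over_n])
    then have "(\<lambda>n. ?b / real (Suc n) + ?k n \<omega> / real (Suc n)) \<longlonglongrightarrow> 0"
      by simp
    moreover have "norm (boundary n \<omega> / real (Suc n)) \<le> ?b / real (Suc n) + ?k n \<omega> / real (Suc n)" for n
      using B(2)[of n \<omega>]
      by (simp add: add_divide_distrib[symmetric] divide_right_mono del: of_nat_Suc)
    ultimately show ?case
      by (rule Lim_null_comparison[OF always_eventually[OF allI], rotated])
  qed
qed

lemma log_trunc_ratio_le:
  assumes "0 \<le> K"
  shows "log_trunc K (ratio n \<omega>) \<le> ln (1 + \<bar>X (Suc n) \<omega>\<bar>) + ln (1 + 1 / \<bar>X n \<omega>\<bar>)"
proof -
  have "0 \<le> ln (1 + \<bar>X (Suc n) \<omega>\<bar>)" "0 \<le> ln (1 + 1 / \<bar>X n \<omega>\<bar>)"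
    by auto
  then have "- K \<le> ln (1 + \<bar>X (Suc n) \<omega>\<bar>) + ln (1 + 1 / \<bar>X n \<omega>\<bar>)"
    using assms by linarith
  then show ?thesis
    using ln_abs_one_plus_divide_le[of "X (Suc n) \<omega>" "X n \<omega>"] by (simp add: log_trunc_def)
qed

lemma log_trunc_ge: "- K \<le> log_trunc K r"
  by (simp add: log_trunc_def)

lemma integrable_log_trunc:
  assumes "0 \<le> K"
  shows "integrable M (\<lambda>\<omega>. log_trunc K (ratio n \<omega>))"
proof (rule Bochner_Integration.integrable_bound)
  show "integrable M (\<lambda>\<omega>. K + (ln (1 + \<bar>X (Suc n) \<omega>\<bar>) + ln (1 + 1 / \<bar>X n \<omega>\<bar>)))"
    by (intro Bochner_Integration.integrable_add integrable_const integrable_ln_abs integrable_ln_inverse)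
  show "AE \<omega> in M. norm (log_trunc K (ratio n \<omega>))
      \<le> norm (K + (ln (1 + \<bar>X (Suc n) \<omega>\<bar>) + ln (1 + 1 / \<bar>X n \<omega>\<bar>)))"
  proof (rule AE_I2)
    fix \<omega>
    have "0 \<le> ln (1 + \<bar>X (Suc n) \<omega>\<bar>)" "0 \<le> ln (1 + 1 / \<bar>X n \<omega>\<bar>)"
      by auto
    then show "norm (log_trunc K (ratio n \<omega>))
        \<le> norm (K + (ln (1 + \<bar>X (Suc n) \<omega>\<bar>) + ln (1 + 1 / \<bar>X n \<omega>\<bar>)))"
      using assms log_trunc_ratio_le[OF assms, of n \<omega>] log_trunc_ge[of K "ratio n \<omega>"]
      unfolding real_norm_def by linarith
  qed
qed measurable

lemma has_ext_expectation_growth: "has_ext_expectation M (growth n)"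
  and growth_pos_finite: "(\<integral>\<^sup>+\<omega>. e2ennreal (growth n \<omega>) \<partial>M) < \<infinity>"
proof -
  have "integrable M (\<lambda>\<omega>. (\<Sum>j<n. log_trunc 0 (ratio j \<omega>)) + boundary n \<omega>)"
    by (intro Bochner_Integration.integrable_add Bochner_Integration.integrable_sum
        integrable_log_trunc integrable_boundary) simp
  from has_ext_expectation_upper[OF measurable_growth this growth_le]
  show "has_ext_expectation M (growth n)" "(\<integral>\<^sup>+\<omega>. e2ennreal (growth n \<omega>) \<partial>M) < \<infinity>" .
qed

lemma measurable_elog_ratio [measurable]: "(\<lambda>\<omega>. elog \<bar>ratio n \<omega>\<bar>) \<in> borel_measurable M"
  by measurable

lemma has_ext_expectation_ratio: "has_ext_expectation M (\<lambda>\<omega>. elog \<bar>ratio n \<omega>\<bar>)"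
  and ratio_pos_finite: "(\<integral>\<^sup>+\<omega>. e2ennreal (elog \<bar>ratio n \<omega>\<bar>) \<partial>M) < \<infinity>"
  using has_ext_expectation_upper[OF measurable_elog_ratio integrable_log_trunc elog_le_log_trunc, of 0]
  by auto

section \<open>Limits when the logarithm of the ratio is integrable\<close>

lemma AE_growth_finite:
  assumes int: "integrable M (\<lambda>\<omega>. ln \<bar>ratio 0 \<omega>\<bar>)"
    and nz: "AE \<omega> in M. \<forall>j. ratio j \<omega> \<noteq> 0"
  shows "AE \<omega> in M. (\<lambda>n. ereal (1 / real (Suc n)) * growth n \<omega>)
    \<longlonglongrightarrow> ereal (expectation (\<lambda>\<omega>. ln \<bar>ratio 0 \<omega>\<bar>))"
proof -
  have "(\<lambda>w. ln \<bar>1 + w 1 / w 0 :: real\<bar>) \<in> borel_measurable (PiM UNIV (\<lambda>_::nat. borel))"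
    by measurable
  from strong_law[OF this]
  have "AE \<omega> in M. (\<lambda>n. (\<Sum>j<n. ln \<bar>ratio j \<omega>\<bar>) / n) \<longlonglongrightarrow> expectation (\<lambda>\<omega>. ln \<bar>ratio 0 \<omega>\<bar>)"
    using int by simp
  then show ?thesis
    using AE_boundary_tendsto nz
  proof eventually_elim
    case (elim \<omega>)
    have "growth n \<omega> = ereal ((\<Sum>j<n. ln \<bar>ratio j \<omega>\<bar>) + boundary n \<omega>)" for n
      using elim(3) by (simp add: growth_eq elog_abs_prod)
    moreover have "(\<lambda>n. (\<Sum>j<n. ln \<bar>ratio j \<omega>\<bar>) / real (Suc n) + boundary n \<omega> / real (Suc n))
        \<longlonglongrightarrow> expectation (\<lambda>\<omega>. ln \<bar>ratio 0 \<omega>\<bar>) + 0"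
      by (intro tendsto_add tendsto_mean_Suc elim)
    ultimately show ?case
      by (simp add: add_divide_distrib)
  qed
qed

lemma ext_expectation_growth_finite:
  assumes int: "integrable M (\<lambda>\<omega>. ln \<bar>ratio 0 \<omega>\<bar>)"
    and nz: "AE \<omega> in M. \<forall>j. ratio j \<omega> \<noteq> 0"
  shows "(\<lambda>n. ereal (1 / real (Suc n)) * ext_expectation M (growth n))
    \<longlonglongrightarrow> ereal (expectation (\<lambda>\<omega>. ln \<bar>ratio 0 \<omega>\<bar>))"
proof -
  let ?e = "expectation (\<lambda>\<omega>. ln \<bar>ratio 0 \<omega>\<bar>)"
  have meas: "(\<lambda>w. ln \<bar>1 + w 1 / w 0 :: real\<bar>) \<in> borel_measurable (PiM UNIV (\<lambda>_::nat. borel))"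
    by measurable
  have int_j: "integrable M (\<lambda>\<omega>. ln \<bar>ratio j \<omega>\<bar>)" for j
    using integrable_tail[OF meas, of j] int by simp
  have e_j: "expectation (\<lambda>\<omega>. ln \<bar>ratio j \<omega>\<bar>) = ?e" for j
    using integral_tail[OF meas, of j] by simp
  have "(\<Sum>j<n. expectation (\<lambda>\<omega>. ln \<bar>ratio j \<omega>\<bar>)) = (\<Sum>j<n. ?e)" for n
    by (rule sum.cong[OF refl e_j])
  then have sum_e: "(\<Sum>j<n. expectation (\<lambda>\<omega>. ln \<bar>ratio j \<omega>\<bar>)) = real n * ?e" for n
    by simp
  have "ext_expectation M (growth n) = ereal (expectation (\<lambda>\<omega>. (\<Sum>j<n. ln \<bar>ratio j \<omega>\<bar>) + boundary n \<omega>))" for n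
  proof (rule ext_expectation_eq_integral)
    show "integrable M (\<lambda>\<omega>. (\<Sum>j<n. ln \<bar>ratio j \<omega>\<bar>) + boundary n \<omega>)"
      by (intro Bochner_Integration.integrable_add Bochner_Integration.integrable_sum int_j integrable_boundary)
    show "AE \<omega> in M. growth n \<omega> = ereal ((\<Sum>j<n. ln \<bar>ratio j \<omega>\<bar>) + boundary n \<omega>)"
      using nz by eventually_elim (simp add: growth_eq elog_abs_prod)
  qed
  then have "ext_expectation M (growth n) = ereal (n * ?e + expectation (boundary n))" for n
    by (simp add: int_j integrable_boundary sum_e)
  moreover have "(\<lambda>n. real n * ?e / real (Suc n) + expectation (boundary n) / real (Suc n)) \<longlonglongrightarrow> ?e + 0"
  proof (rule tendsto_add[OF tendsto_mean_Suc expectation_boundary_tendsto])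
    have "\<forall>\<^sub>F n in sequentially. ?e = real n * ?e / real n"
      using eventually_gt_at_top[of 0] by eventually_elim simp
    then show "(\<lambda>n. real n * ?e / real n) \<longlonglongrightarrow> ?e"
      by (rule Lim_transform_eventually[OF tendsto_const])
  qed
  ultimately show ?thesis
    by (simp add: add_divide_distrib)
qed

section \<open>Limits when the negative part has infinite mean\<close>

lemma ext_expectation_growth_MInfty:
  assumes neg: "(\<integral>\<^sup>+\<omega>. e2ennreal (- elog \<bar>ratio 0 \<omega>\<bar>) \<partial>M) = \<infinity>"
  shows "ext_expectation M (growth (Suc n)) = -\<infinity>"
proof (rule ext_expectation_eq_MInfty[OF measurable_growth measurable_elog_ratio _ _ growth_pos_finite neg])
  \<comment> \<open>One ratio already forces -\<infinity>: all others are replaced by their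
    integrable positive parts and moved into \<open>?u\<close> together with the boundary term. The
    index \<open>Suc n\<close> guarantees that \<open>ratio 0\<close> occurs.\<close>
  let ?u = "\<lambda>\<omega>. (\<Sum>j<n. log_trunc 0 (ratio (Suc j) \<omega>)) + boundary (Suc n) \<omega>"
  show "integrable M ?u"
    by (intro Bochner_Integration.integrable_add Bochner_Integration.integrable_sum
        integrable_log_trunc integrable_boundary) simp
  fix \<omega>
  let ?p = "\<Prod>j<n. ratio (Suc j) \<omega>"
  have "elog \<bar>\<Prod>j<Suc n. ratio j \<omega>\<bar> = elog \<bar>ratio 0 \<omega> * ?p\<bar>"
    by (subst prod.lessThan_Suc_shift) simp
  also have "\<dots> \<le> elog \<bar>ratio 0 \<omega>\<bar> + elog \<bar>?p\<bar>"
    by (cases "?p = 0") (auto simp: elog_def abs_mult ln_mult)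
  also have "\<dots> \<le> elog \<bar>ratio 0 \<omega>\<bar> + ereal (\<Sum>j<n. log_trunc 0 (ratio (Suc j) \<omega>))"
    by (intro add_left_mono elog_abs_prod_le) simp
  finally show "growth (Suc n) \<omega> \<le> elog \<bar>ratio 0 \<omega>\<bar> + ereal (?u \<omega>)"
    unfolding growth_eq plus_ereal.simps(1)[symmetric] add.assoc[symmetric]
    by (rule add_right_mono)
qed

text \<open>The truncated negative parts increase to the full one, whose integral is infinite, while
  the positive part keeps a fixed finite mean.\<close>

lemma expectation_log_trunc_unbounded:
  assumes neg: "(\<integral>\<^sup>+\<omega>. e2ennreal (- elog \<bar>ratio 0 \<omega>\<bar>) \<partial>M) = \<infinity>"
  obtains K where "0 \<le> K" "expectation (\<lambda>\<omega>. log_trunc K (ratio 0 \<omega>)) < b"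
proof -
  let ?g = "\<lambda>K \<omega>. log_trunc K (ratio 0 \<omega>)"
  let ?p = "\<lambda>K \<omega>. max 0 (- ?g K \<omega>)"
  \<comment> \<open>At 0 the truncations run through all naturals; elsewhere the supremum is
    attained once \<open>k\<close> reaches \<open>- ln \<bar>r\<bar>\<close>.\<close>
  have sup: "(SUP k. ennreal (max 0 (- log_trunc (real k) r))) = e2ennreal (- elog \<bar>r\<bar>)" for r
  proof (cases "r = 0")
    case True
    then have "(SUP k. ennreal (max 0 (- log_trunc (real k) r))) = (SUP k. of_nat k)"
      by (simp add: log_trunc_def ennreal_of_nat_eq_real_of_nat)
    then show ?thesis
      using True by (simp add: elog_def ennreal_SUP_of_nat_eq_top)
  next
    case False
    have "ennreal (max 0 (- log_trunc (real k) r)) \<le> ennreal (max 0 (- ln \<bar>r\<bar>))" for k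
      using False by (intro ennreal_leI) (auto simp: log_trunc_def)
    moreover have "ennreal (max 0 (- ln \<bar>r\<bar>)) = ennreal (- ln \<bar>r\<bar>)"
      by (simp add: max_def ennreal_neg)
    ultimately have "ennreal (max 0 (- log_trunc (real k) r)) \<le> ennreal (- ln \<bar>r\<bar>)" for k
      by simp
    moreover have "ennreal (- ln \<bar>r\<bar>) \<le> ennreal (max 0 (- log_trunc (real (nat \<lceil>- ln \<bar>r\<bar>\<rceil>)) r))"
    proof (rule ennreal_leI)
      have "- ln \<bar>r\<bar> \<le> real (nat \<lceil>- ln \<bar>r\<bar>\<rceil>)"
        by (rule real_nat_ceiling_ge)
      then show "- ln \<bar>r\<bar> \<le> max 0 (- log_trunc (real (nat \<lceil>- ln \<bar>r\<bar>\<rceil>)) r)"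
        using False by (simp add: log_trunc_def)
    qed
    ultimately have "(SUP k. ennreal (max 0 (- log_trunc (real k) r))) = ennreal (- ln \<bar>r\<bar>)"
      by (intro antisym SUP_least) (auto intro: SUP_upper2)
    then show ?thesis
      using False by (simp add: elog_def)
  qed
  have "(SUP k. \<integral>\<^sup>+\<omega>. ennreal (?p (real k) \<omega>) \<partial>M) = (\<integral>\<^sup>+\<omega>. (SUP k. ennreal (?p (real k) \<omega>)) \<partial>M)"
    by (rule nn_integral_monotone_convergence_SUP[symmetric])
      (auto simp: incseq_def le_fun_def intro!: ennreal_leI max.mono log_trunc_antimono)
  also have "\<dots> = \<infinity>"
    unfolding sup by (rule neg)
  finally have SUP: "(SUP k. \<integral>\<^sup>+\<omega>. ennreal (?p (real k) \<omega>) \<partial>M) = \<infinity>" .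
  \<comment> \<open>Chosen so that subtracting more than \<open>?c\<close> from the mean of the
    positive part leaves a value below \<open>b\<close>, whatever the signs.\<close>
  let ?c = "\<bar>expectation (?g 0)\<bar> + \<bar>b\<bar>"
  have "ennreal ?c < (SUP k. \<integral>\<^sup>+\<omega>. ennreal (?p (real k) \<omega>) \<partial>M)"
    unfolding SUP by simp
  then obtain k :: nat where k: "ennreal ?c < (\<integral>\<^sup>+\<omega>. ennreal (?p (real k) \<omega>) \<partial>M)"
    by (auto simp: less_SUP_iff)
  have int: "integrable M (?g (real k))" "integrable M (?g 0)"
    by (auto intro: integrable_log_trunc)
  then have intp: "integrable M (?p (real k))"
    by auto
  have "ennreal ?c < ennreal (expectation (?p (real k)))"
    using k nn_integral_eq_integral[OF intp] by simp
  then have "?c < expectation (?p (real k))"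
    by (subst (asm) ennreal_less_iff) auto
  moreover have "expectation (?g (real k)) = expectation (?g 0) - expectation (?p (real k))"
  proof -
    have "expectation (?g (real k)) = expectation (\<lambda>\<omega>. ?g 0 \<omega> - ?p (real k) \<omega>)"
      by (intro Bochner_Integration.integral_cong refl log_trunc_split) simp
    also have "\<dots> = expectation (?g 0) - expectation (?p (real k))"
      by (rule Bochner_Integration.integral_diff[OF int(2) intp])
    finally show ?thesis .
  qed
  ultimately show thesis
    by (intro that[of "real k"]) auto
qed

text \<open>For each natural \<open>m\<close> a level \<open>K\<close> puts the truncated mean below
  \<open>- m\<close>, and the strong law for this truncation bounds the growth from above. Countably
  many \<open>m\<close> cost one null set.\<close>

lemma AE_growth_MInfty:
  assumes neg: "(\<integral>\<^sup>+\<omega>. e2ennreal (- elog \<bar>ratio 0 \<omega>\<bar>) \<partial>M) = \<infinity>"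
  shows "AE \<omega> in M. (\<lambda>n. ereal (1 / real (Suc n)) * growth n \<omega>) \<longlonglongrightarrow> -\<infinity>"
proof -
  have "AE \<omega> in M. \<forall>\<^sub>F n in sequentially. ereal (1 / real (Suc n)) * growth n \<omega> < ereal (- real m)" for m :: nat
  proof -
    obtain K where K: "0 \<le> K" "expectation (\<lambda>\<omega>. log_trunc K (ratio 0 \<omega>)) < - real m"
      using expectation_log_trunc_unbounded[OF neg] .
    have "(\<lambda>w. log_trunc K (1 + w 1 / w 0)) \<in> borel_measurable (PiM UNIV (\<lambda>_::nat. borel))"
      by measurable
    from strong_law[OF this]
    have "AE \<omega> in M. (\<lambda>n. (\<Sum>j<n. log_trunc K (ratio j \<omega>)) / n)
        \<longlonglongrightarrow> expectation (\<lambda>\<omega>. log_trunc K (ratio 0 \<omega>))"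
      using integrable_log_trunc[OF K(1), of 0] by simp
    then show ?thesis
      using AE_boundary_tendsto
    proof eventually_elim
      case (elim \<omega>)
      have "(\<lambda>n. (\<Sum>j<n. log_trunc K (ratio j \<omega>)) / real (Suc n) + boundary n \<omega> / real (Suc n))
          \<longlonglongrightarrow> expectation (\<lambda>\<omega>. log_trunc K (ratio 0 \<omega>)) + 0"
        by (intro tendsto_add tendsto_mean_Suc elim)
      then have "\<forall>\<^sub>F n in sequentially.
          (\<Sum>j<n. log_trunc K (ratio j \<omega>)) / real (Suc n) + boundary n \<omega> / real (Suc n) < - real m"
        by (rule order_tendstoD) (use K in simp)
      then show ?case
      proof eventually_elim
        case (elim n)
        have "ereal (1 / real (Suc n)) * growth n \<omega>
            \<le> ereal (1 / real (Suc n)) * ereal ((\<Sum>j<n. log_trunc K (ratio j \<omega>)) + boundary n \<omega>)"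
          by (intro ereal_mult_left_mono growth_le) simp
        also have "\<dots> = ereal ((\<Sum>j<n. log_trunc K (ratio j \<omega>)) / real (Suc n) + boundary n \<omega> / real (Suc n))"
          by (simp add: add_divide_distrib)
        also have "\<dots> < ereal (- real m)"
          using elim by simp
        finally show ?case .
      qed
    qed
  qed
  then have "AE \<omega> in M. \<forall>m::nat. \<forall>\<^sub>F n in sequentially.
      ereal (1 / real (Suc n)) * growth n \<omega> < ereal (- real m)"
    by (subst AE_all_countable) blast
  then show ?thesis
  proof eventually_elim
    case (elim \<omega>)
    show ?case
      unfolding tendsto_MInfty
    proof
      fix r :: real
      from elim have "\<forall>\<^sub>F n in sequentially.
          ereal (1 / real (Suc n)) * growth n \<omega> < ereal (- real (nat \<lceil>- r\<rceil>))"
        by blast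
      then show "\<forall>\<^sub>F n in sequentially. ereal (1 / real (Suc n)) * growth n \<omega> < ereal r"
      proof eventually_elim
        case (elim n)
        also have "ereal (- real (nat \<lceil>- r\<rceil>)) \<le> ereal r"
          using real_nat_ceiling_ge[of "- r"] by simp
        finally show ?case .
      qed
    qed
  qed
qed

theorem growth_limit:
  defines "v \<equiv> ext_expectation M (\<lambda>\<omega>. elog \<bar>ratio 0 \<omega>\<bar>)"
  shows "(\<lambda>n. ereal (1 / real (Suc n)) * ext_expectation M (growth n)) \<longlonglongrightarrow> v"
    and "AE \<omega> in M. (\<lambda>n. ereal (1 / real (Suc n)) * growth n \<omega>) \<longlonglongrightarrow> v"
    and "v < \<infinity>"
proof -
  have "(\<lambda>n. ereal (1 / real (Suc n)) * ext_expectation M (growth n)) \<longlonglongrightarrow> v \<and>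
    (AE \<omega> in M. (\<lambda>n. ereal (1 / real (Suc n)) * growth n \<omega>) \<longlonglongrightarrow> v) \<and> v < \<infinity>"
  proof (cases "(\<integral>\<^sup>+\<omega>. e2ennreal (- elog \<bar>ratio 0 \<omega>\<bar>) \<partial>M) = \<infinity>")
    case True
    have v: "v = -\<infinity>"
      unfolding v_def
      by (rule ext_expectation_eq_MInfty[OF measurable_elog_ratio measurable_elog_ratio
            integrable_zero _ ratio_pos_finite True]) simp
    \<comment> \<open>\<open>growth 0\<close> contains no ratio and has finite mean, so the constant
      value -\<infinity> starts at index 1.\<close>
    have "(\<lambda>n. ereal (1 / real (Suc (Suc n))) * ext_expectation M (growth (Suc n))) \<longlonglongrightarrow> -\<infinity>"
      by (simp add: ext_expectation_growth_MInfty[OF True])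
    then have "(\<lambda>n. ereal (1 / real (Suc n)) * ext_expectation M (growth n)) \<longlonglongrightarrow> -\<infinity>"
      by (rule LIMSEQ_imp_Suc)
    with AE_growth_MInfty[OF True] show ?thesis
      by (simp add: v)
  next
    case False
    have "AE \<omega> in M. e2ennreal (- elog \<bar>ratio 0 \<omega>\<bar>) \<noteq> \<infinity>"
      by (rule nn_integral_noteq_infinite[OF _ False]) measurable
    \<comment> \<open>A vanishing ratio would make the negative part infinite, which happens only on
      a null set.\<close>
    then have nz0: "AE \<omega> in M. ratio 0 \<omega> \<noteq> 0"
      by eventually_elim (auto simp: elog_def)
    have "AE \<omega> in M. ratio j \<omega> \<noteq> 0" for j
    proof -
      \<comment> \<open>The indicator turns the null event for \<open>ratio 0\<close> into an
        integral, which stationarity carries over to \<open>ratio j\<close>.\<close>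
      let ?f = "\<lambda>w::nat \<Rightarrow> real. indicator {0::real} (1 + w 1 / w 0) :: ennreal"
      have f: "?f \<in> borel_measurable (PiM UNIV (\<lambda>_. borel))"
        by measurable
      have "(\<integral>\<^sup>+\<omega>. indicator {0} (ratio j \<omega>) \<partial>M) = (\<integral>\<^sup>+\<omega>. indicator {0} (ratio 0 \<omega>) \<partial>M)"
        using nn_integral_tail[OF f, of j] by simp
      also have "\<dots> = (\<integral>\<^sup>+\<omega>. 0 \<partial>M)"
        using nz0 by (intro nn_integral_cong_AE) (auto elim: eventually_mono)
      finally have "(\<integral>\<^sup>+\<omega>. indicator {0} (ratio j \<omega>) \<partial>M) = 0"
        by simp
      then have "AE \<omega> in M. indicator {0} (ratio j \<omega>) = (0::ennreal)"
        by (subst (asm) nn_integral_0_iff_AE) measurable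
      then show ?thesis
        by eventually_elim (auto simp: indicator_def split: if_splits)
    qed
    then have nz: "AE \<omega> in M. \<forall>j. ratio j \<omega> \<noteq> 0"
      by (subst AE_all_countable) blast
    have int: "integrable M (\<lambda>\<omega>. ln \<bar>ratio 0 \<omega>\<bar>)"
    proof (rule integrableI_bounded)
      have "(\<integral>\<^sup>+\<omega>. ennreal (norm (ln \<bar>ratio 0 \<omega>\<bar>)) \<partial>M)
          \<le> (\<integral>\<^sup>+\<omega>. e2ennreal (elog \<bar>ratio 0 \<omega>\<bar>) + e2ennreal (- elog \<bar>ratio 0 \<omega>\<bar>) \<partial>M)"
      proof (rule nn_integral_mono)
        fix \<omega>
        show "ennreal (norm (ln \<bar>ratio 0 \<omega>\<bar>))
            \<le> e2ennreal (elog \<bar>ratio 0 \<omega>\<bar>) + e2ennreal (- elog \<bar>ratio 0 \<omega>\<bar>)"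
          by (cases "0 \<le> ln \<bar>ratio 0 \<omega>\<bar>") (simp_all add: elog_def ennreal_neg)
      qed
      also have "\<dots> = (\<integral>\<^sup>+\<omega>. e2ennreal (elog \<bar>ratio 0 \<omega>\<bar>) \<partial>M) + (\<integral>\<^sup>+\<omega>. e2ennreal (- elog \<bar>ratio 0 \<omega>\<bar>) \<partial>M)"
        by (rule nn_integral_add) measurable
      also have "\<dots> < \<infinity>"
        using ratio_pos_finite[of 0] False by (simp add: less_top)
      finally show "(\<integral>\<^sup>+\<omega>. ennreal (norm (ln \<bar>ratio 0 \<omega>\<bar>)) \<partial>M) < \<infinity>" .
    qed measurable
    have "v = ereal (expectation (\<lambda>\<omega>. ln \<bar>ratio 0 \<omega>\<bar>))"
      unfolding v_def
      by (rule ext_expectation_eq_integral[OF int])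
        (use nz0 in eventually_elim, simp add: elog_def)
    with AE_growth_finite[OF int nz] ext_expectation_growth_finite[OF int nz] show ?thesis
      by simp
  qed
  then show "(\<lambda>n. ereal (1 / real (Suc n)) * ext_expectation M (growth n)) \<longlonglongrightarrow> v"
    and "AE \<omega> in M. (\<lambda>n. ereal (1 / real (Suc n)) * growth n \<omega>) \<longlonglongrightarrow> v"
    and "v < \<infinity>"
    by auto
qed

end

theorem theorem1:
  fixes M :: "'a measure"
    and x :: "nat \<Rightarrow> 'a \<Rightarrow> real"
    and Y S :: "nat \<Rightarrow> 'a \<Rightarrow> real^2^2"
    and N :: "real^2^2 \<Rightarrow> real"
    and L :: ereal
  assumes "prob_space M"
    and indep: "prob_space.indep_vars M (\<lambda>_. borel) x {1..}"
    and ident: "\<And>j. j \<ge> 1 \<Longrightarrow> distr M borel (x j) = distr M borel (x 1)"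
    and nonzero: "\<And>j \<omega>. j \<ge> 1 \<Longrightarrow> \<omega> \<in> space M \<Longrightarrow> x j \<omega> \<noteq> 0"
    and moment: "(\<integral>\<^sup>+\<omega>. ennreal (ln (1 + \<bar>x 1 \<omega>\<bar>)) \<partial>M) < \<infinity>"
    and moment_inverse: "(\<integral>\<^sup>+\<omega>. ennreal (ln (1 + 1 / \<bar>x 1 \<omega>\<bar>)) \<partial>M) < \<infinity>"
    and Y: "Y = (\<lambda>j \<omega>. Y_mat (x j \<omega>))"
    and S: "S = partial_product Y"
    and N: "matrix_norm N"
    and L: "L = lyapunov_exponent M N Y"
  shows "(\<forall>n\<ge>1. has_ext_expectation M (\<lambda>\<omega>. elog (N (S n \<omega>)))) \<and>
     mean_log_growth M N Y \<longlonglongrightarrow> L \<and>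
     (AE \<omega> in M. (\<lambda>n. ereal (1 / real n) * elog (N (S n \<omega>))) \<longlonglongrightarrow> L) \<and>
     L < \<infinity> \<and>
     has_ext_expectation M (\<lambda>\<omega>. elog \<bar>1 + x 2 \<omega> / x 1 \<omega>\<bar>) \<and>
     L = ext_expectation M (\<lambda>\<omega>. elog \<bar>1 + x 2 \<omega> / x 1 \<omega>\<bar>)"
proof -
  interpret prob_space M by fact
  have range_Suc_eq: "range Suc = {1..}"
    by (auto simp: image_iff Suc_le_eq gr0_conv_Suc)
  have "indep_vars (\<lambda>_. borel) (\<lambda>j. x (Suc j)) UNIV"
    using indep_vars_reindex[of "\<lambda>_. borel" x Suc UNIV] indep
    by (simp add: range_Suc_eq)
  then interpret G: rank_one_growth M "\<lambda>j. x (Suc j)" N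
  proof unfold_locales
    show "distr M borel (x (Suc j)) = distr M borel (x (Suc 0))" for j
      using ident[of "Suc j"] by simp
  qed (use nonzero moment moment_inverse N in simp_all)
  let ?Z = "\<lambda>\<omega>. elog \<bar>1 + x 2 \<omega> / x 1 \<omega>\<bar>"
  \<comment> \<open>Telescoping is applied pointwise on \<open>space M\<close>, the only place where
    the \<open>x j\<close> are assumed nonzero.\<close>
  have growth: "elog (N (S (Suc n) \<omega>)) = G.growth n \<omega>" if "\<omega> \<in> space M" for n \<omega>
    using partial_product_Y_mat[of x \<omega> n] nonzero[OF _ that]
    by (simp add: S Y G.growth_def del: partial_product.simps)
  have growth_mean: "mean_log_growth M N Y (Suc n) = ereal (1 / real (Suc n)) * ext_expectation M (G.growth n)" for n
    unfolding mean_log_growth_def S[symmetric]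
    by (subst ext_expectation_cong(1)[OF growth]) auto
  have Z: "(\<lambda>\<omega>. elog \<bar>1 + x (Suc (Suc 0)) \<omega> / x (Suc 0) \<omega>\<bar>) = ?Z"
    by (simp add: numeral_2_eq_2)
  \<comment> \<open>\<open>LIMSEQ_imp_Suc\<close> discards index 0, where the prefactor is a
    division by 0 and the product is the identity.\<close>
  have conv: "mean_log_growth M N Y \<longlonglongrightarrow> ext_expectation M ?Z"
    using G.growth_limit(1) unfolding Z growth_mean[symmetric] by (rule LIMSEQ_imp_Suc)
  \<comment> \<open>\<open>lim\<close> names the limit only for a convergent sequence, so
    \<open>L\<close> is identified after convergence is known.\<close>
  then have L_eq: "L = ext_expectation M ?Z"
    unfolding L lyapunov_exponent_def by (rule limI)
  have "has_ext_expectation M (\<lambda>\<omega>. elog (N (S n \<omega>)))" if "n \<ge> 1" for n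
  proof -
    obtain m where m: "n = Suc m"
      using \<open>n \<ge> 1\<close> by (cases n) auto
    show ?thesis
      unfolding m by (subst ext_expectation_cong(2)[OF growth]) (simp_all add: G.has_ext_expectation_growth)
  qed
  moreover have "AE \<omega> in M. (\<lambda>n. ereal (1 / real n) * elog (N (S n \<omega>))) \<longlonglongrightarrow> L"
    using G.growth_limit(2) AE_space
  proof eventually_elim
    case (elim \<omega>)
    then have "(\<lambda>n. ereal (1 / real (Suc n)) * elog (N (S (Suc n) \<omega>))) \<longlonglongrightarrow> L"
      unfolding Z L_eq growth[OF elim(2)] by simp
    then show ?case
      by (rule LIMSEQ_imp_Suc)
  qed
  ultimately show ?thesis
    using conv G.growth_limit(3) G.has_ext_expectation_ratio[of 0] unfolding Z L_eq by blast
qed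

end
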